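(* Let $t,r\ge 1$. Let $H$ be a random $r\times t$ complex matrix that is full rank with probability $1$, with $E\|H\|_F^2<\infty$, and with $E|\log\det(H^*H)|<\infty$ if $t\le r$, respectively $E|\log\det(HH^* )|<\infty$ if $t>r$. Let $\hat H$ be any random variable jointly distributed with $H$ (including the no-CSIT case in which $\hat H$ is independent of $H$). Fix a positive definite $r\times r$ matrix $\Sigma_Z$ and a positive semidefinite $t\times t$ matrix $\Sigma_S'$, and for $P>0$ set $\Sigma_S=P\Sigma_S'$. For a positive definite $t\times t$ matrix $\Sigma_X$ define \[ R(\Sigma_X)=E_{\hat H}\Big( E_{H|\hat H}\log\big\{|\Sigma_X|\,|H(\Sigma_X+\Sigma_S)H^*+\Sigma_Z|\big\} - \inf_{W\in\mathbb{C}^{t\times t}} E_{H|\hat H}\log|M(W,H)|\Big), \] \[ M(W,H)=\begin{pmatrix}\Sigma_X+W\Sigma_S W^* & (\Sigma_X+W\Sigma_S)H^*\\ H(\Sigma_X+\Sigma_S W^* ) & H(\Sigma_X+\Sigma_S)H^*+\Sigma_Z\end{pmatrix}, \] and let $R(P)=\sup\{R(\Sigma_X): \Sigma_X\succ 0,\ \mathrm{tr}(\Sigma_X)\le P\}$. Then, with $\mathrm{SNR}=P/|\Sigma_Z|$, \[ \lim_{P\to\infty}\frac{R(P)}{\log \mathrm{SNR}}=\min(t,r), \] i.e. the rate achievable by dirty paper coding over the fading dirty paper channel with no (and hence with partial) CSIT scales optimally as $\min(r,t)\log\mathrm{SNR}$.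
   Context: The $t\times r$ fading dirty paper channel (FDPC) is $Y=H(X+S)+Z$, where $X\sim\mathcal{CN}(0,\Sigma_X)\in\mathbb{C}^t$ is the transmitted signal with power constraint $\mathrm{tr}(\Sigma_X)\le P$, $S\sim\mathcal{CN}(0,\Sigma_S)$ is interference known non-causally at the transmitter but not at the receiver, $Z\sim\mathcal{CN}(0,\Sigma_Z)\in\mathbb{C}^r$ is noise, and $X,S,Z$ are independent. The fading matrix $H$ is known perfectly at the receiver, while the transmitter only knows $\hat H$ (partial CSIT). Dirty paper coding uses the auxiliary random variable $U=X+WS$ with $t\times t$ inflation factor $W$ (chosen as a function of $\hat H$), and $R(\Sigma_X)$ is the resulting achievable rate. $|A|$ denotes determinant and $A^*$ conjugate transpose. *)

theory Defs
  imports "HOL-Analysis.Analysis" "HOL-Probability.Probability"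
begin

definition ctrans :: "complex^'n^'m \<Rightarrow> complex^'m^'n" where
  "ctrans A = (\<chi> i j. cnj (A $ j $ i))"

definition hermitian :: "complex^'n^'n \<Rightarrow> bool" where
  "hermitian A \<longleftrightarrow> ctrans A = A"

definition qform :: "complex^'n^'n \<Rightarrow> complex^'n \<Rightarrow> complex" where
  "qform A x = (\<Sum>i\<in>UNIV. cnj (x $ i) * (A *v x) $ i)"

definition pos_def :: "complex^'n^'n \<Rightarrow> bool" where
  "pos_def A \<longleftrightarrow> hermitian A \<and> (\<forall>x. x \<noteq> 0 \<longrightarrow> 0 < Re (qform A x))"

definition pos_semidef :: "complex^'n^'n \<Rightarrow> bool" where
  "pos_semidef A \<longleftrightarrow> hermitian A \<and> (\<forall>x. 0 \<le> Re (qform A x))"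

definition block :: "complex^'t^'t \<Rightarrow> complex^'r^'t \<Rightarrow> complex^'t^'r \<Rightarrow> complex^'r^'r
    \<Rightarrow> complex^('t + 'r)^('t + 'r)" where
  "block A B C D = (\<chi> i j. case i of
       Inl a \<Rightarrow> (case j of Inl b \<Rightarrow> A $ a $ b | Inr b \<Rightarrow> B $ a $ b)
     | Inr a \<Rightarrow> (case j of Inl b \<Rightarrow> C $ a $ b | Inr b \<Rightarrow> D $ a $ b))"

text \<open>The matrix M(W,H) (joint covariance of U = X + W S and Y = H(X+S)+Z).\<close>
definition Mmat :: "complex^'t^'t \<Rightarrow> complex^'t^'t \<Rightarrow> complex^'r^'r \<Rightarrow> complex^'t^'t
    \<Rightarrow> complex^'t^'r \<Rightarrow> complex^('t + 'r)^('t + 'r)" where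
  "Mmat SX SS SZ W H = block
     (SX + W ** SS ** ctrans W)
     ((SX + W ** SS) ** ctrans H)
     (H ** (SX + SS ** ctrans W))
     (H ** (SX + SS) ** ctrans H + SZ)"

text \<open>Log-determinant (natural log; the base cancels in the ratio of the theorem).\<close>
definition logdet :: "complex^'n^'n \<Rightarrow> real" where
  "logdet A = ln (cmod (det A))"

text \<open>DPC rate R(Sigma_X). The joint law of (H-hat, H) is given by the law mu of H-hat
  together with a regular conditional distribution K (H-hat = b |-> law of H given H-hat = b).\<close>
definition dpc_rate :: "'b measure \<Rightarrow> ('b \<Rightarrow> (complex^'t^'r) measure)
    \<Rightarrow> complex^'r^'r \<Rightarrow> complex^'t^'t \<Rightarrow> complex^'t^'t \<Rightarrow> real" where
  "dpc_rate mu K SZ SS SX =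
     (\<integral>b. ((\<integral>h. logdet SX + logdet (h ** (SX + SS) ** ctrans h + SZ) \<partial>(K b))
           - (INF W. \<integral>h. logdet (Mmat SX SS SZ W h) \<partial>(K b))) \<partial>mu)"

definition dpc_rate_P :: "'b measure \<Rightarrow> ('b \<Rightarrow> (complex^'t^'r) measure)
    \<Rightarrow> complex^'r^'r \<Rightarrow> complex^'t^'t \<Rightarrow> real \<Rightarrow> real" where
  "dpc_rate_P mu K SZ SS' P =
     (SUP SX \<in> {SX :: complex^'t^'t. pos_def SX \<and> Re (trace SX) \<le> P}.
        dpc_rate mu K SZ (P *\<^sub>R SS') SX)"

end

theory Submission
  imports Defs "HOL-Real_Asymp.Real_Asymp"
begin

text \<open>
  Upper bound: for every inflation factor \<open>W\<close> the joint covariance of \<open>(U, Y)\<close> has determinant at least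
  \<open>|\<Sigma>\<^sub>X| |\<Sigma>\<^sub>Z|\<close>, so the conditional rate is at most
  \<open>E log (|H (\<Sigma>\<^sub>X + \<Sigma>\<^sub>S) H\<^sup>* + \<Sigma>\<^sub>Z| / |\<Sigma>\<^sub>Z|)\<close>. Since \<open>\<Sigma>\<^sub>X + \<Sigma>\<^sub>S\<close> is bounded by a
  multiple of \<open>P\<close>, Sylvester's identity \<open>|1 + A B| = |1 + B A|\<close> lets one work with matrices of size
  \<open>min(t,r)\<close> and yields \<open>min(t,r) log P + O(1)\<close>.

  Lower bound: take \<open>\<Sigma>\<^sub>X = (P/t) 1\<close> and \<open>W = 1\<close>. Then \<open>|M| = |\<Sigma>\<^sub>X + \<Sigma>\<^sub>S| |\<Sigma>\<^sub>Z|\<close>, the ratio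
  \<open>|\<Sigma>\<^sub>X| / |\<Sigma>\<^sub>X + \<Sigma>\<^sub>S|\<close> does not depend on \<open>P\<close>, and
  \<open>|H (\<Sigma>\<^sub>X + \<Sigma>\<^sub>S) H\<^sup>* + \<Sigma>\<^sub>Z|\<close> is at least a constant times \<open>P\<close> to the power \<open>min(t,r)\<close> times
  the Gram determinant of \<open>H\<close>, whose logarithm is integrable.

  Since the rate contains an infimum over uncountably many \<open>W\<close>, its measurability in the side information
  has to be proved: where \<open>E log (1 + |H|\<^sup>2)\<close> is finite, \<open>E log |M(W,H)|\<close> is continuous in \<open>W\<close> and a
  countable dense set of \<open>W\<close> suffices.
\<close>

section \<open>Sesquilinear algebra of complex matrices\<close>

lemma ctrans_nth [simp]: "ctrans A $ i $ j = cnj (A $ j $ i)"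
  by (simp add: ctrans_def)

lemma ctrans_ctrans [simp]: "ctrans (ctrans A) = A"
  by (simp add: vec_eq_iff)

lemma ctrans_0 [simp]: "ctrans 0 = 0"
  by (simp add: vec_eq_iff)

lemma ctrans_add: "ctrans (A + B) = ctrans A + ctrans B"
  by (simp add: vec_eq_iff)

lemma ctrans_diff: "ctrans (A - B) = ctrans A - ctrans B"
  by (simp add: vec_eq_iff)

lemma ctrans_mat_1 [simp]: "ctrans (mat 1) = mat 1"
  by (simp add: vec_eq_iff mat_def)

lemma ctrans_scaleR: "ctrans (c *\<^sub>R A) = c *\<^sub>R ctrans A"
  by (simp add: vec_eq_iff)

lemma ctrans_mult: "ctrans (A ** B) = ctrans B ** ctrans A"
  by (simp add: vec_eq_iff matrix_matrix_mult_def mult.commute)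

lemma det_ctrans: "det (ctrans A) = cnj (det A)"
proof -
  have "ctrans A = transpose (\<chi> i j. cnj (A $ i $ j))"
    by (simp add: vec_eq_iff transpose_def)
  moreover have "det (\<chi> i j. cnj (A $ i $ j)) = cnj (det A)"
    by (simp add: det_def)
  ultimately show ?thesis
    by (simp add: det_transpose)
qed

lemma matrix_mult_scaleR_left: "(c *\<^sub>R A) ** B = c *\<^sub>R (A ** B)" for A :: "complex^'n^'m"
  by (simp add: vec_eq_iff matrix_matrix_mult_def scaleR_sum_right)

lemma matrix_mult_scaleR_right: "A ** (c *\<^sub>R B) = c *\<^sub>R (A ** B)" for A :: "complex^'n^'m"
  by (simp add: vec_eq_iff matrix_matrix_mult_def scaleR_sum_right)

lemma matrix_vector_mult_scaleR_left: "(c *\<^sub>R A) *v x = c *\<^sub>R (A *v x)" for A :: "complex^'n^'m"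
  by (simp add: vec_eq_iff matrix_vector_mult_def scaleR_sum_right)

lemma matrix_add_rdistrib: "(A + B) ** C = A ** C + B ** C" for A :: "complex^'n^'m"
  by (simp add: vec_eq_iff matrix_matrix_mult_def sum.distrib distrib_right)

lemma matrix_diff_ldistrib: "A ** (B - C) = A ** B - A ** C" for A :: "complex^'n^'m"
  by (simp add: vec_eq_iff matrix_matrix_mult_def sum_subtractf right_diff_distrib)

lemma matrix_diff_rdistrib: "(A - B) ** C = A ** C - B ** C" for A :: "complex^'n^'m"
  by (simp add: vec_eq_iff matrix_matrix_mult_def sum_subtractf left_diff_distrib)

lemma matrix_minus_left: "(- A) ** B = - (A ** B)" for A :: "complex^'n^'m"
  by (simp add: vec_eq_iff matrix_matrix_mult_def sum_negf)

lemma matrix_minus_right: "A ** (- B) = - (A ** B)" for A :: "complex^'n^'m"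
  by (simp add: vec_eq_iff matrix_matrix_mult_def sum_negf)

lemma det_scaleR: "det (c *\<^sub>R A) = of_real c ^ CARD('n) * det A" for A :: "complex^'n^'n"
proof -
  have "c *\<^sub>R A = (\<chi> i. of_real c *s A $ i)"
    by (simp add: vec_eq_iff) (simp add: scaleR_conv_of_real)
  then show ?thesis
    using det_rows_mul[of "\<lambda>_. of_real c" "\<lambda>i. A $ i"] by (simp add: vec_lambda_eta)
qed

section \<open>The Hermitian inner product and the Frobenius norm\<close>

definition cdot :: "complex^'n \<Rightarrow> complex^'n \<Rightarrow> complex" where
  "cdot x y = (\<Sum>i\<in>UNIV. cnj (x $ i) * y $ i)"

lemma cdot_add_right: "cdot x (y + z) = cdot x y + cdot x z"
  and cdot_diff_left: "cdot (x - y) z = cdot x z - cdot y z"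
  and cdot_diff_right: "cdot x (y - z) = cdot x y - cdot x z"
  and cdot_scale_left: "cdot (c *s x) y = cnj c * cdot x y"
  and cdot_scale_right: "cdot x (c *s y) = c * cdot x y"
  and cnj_cdot: "cnj (cdot x y) = cdot y x"
  by (simp_all add: cdot_def algebra_simps sum.distrib sum_subtractf sum_distrib_left)

lemma cdot_scaleR_right: "cdot x (r *\<^sub>R y) = of_real r * cdot x y"
  by (simp add: cdot_def sum_distrib_left) (simp add: scaleR_conv_of_real mult_ac)

lemma cdot_self: "cdot x x = of_real ((norm x)\<^sup>2)"
  by (simp add: cdot_def norm_vec_def L2_set_def real_sqrt_pow2 sum_nonneg
      complex_norm_square mult.commute del: of_real_power)

lemma cdot_matrix_right: "cdot x (A *v y) = cdot (ctrans A *v x) y"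
  unfolding cdot_def matrix_vector_mult_def
  by (simp add: sum_distrib_left sum_distrib_right mult_ac) (rule sum.swap)

lemma qform_eq_cdot: "qform A x = cdot x (A *v x)"
  by (simp add: qform_def cdot_def)

lemma cdot_hermitian: "hermitian A \<Longrightarrow> cdot x (A *v y) = cdot (A *v x) y"
  by (simp add: cdot_matrix_right hermitian_def)

lemma norm_ctrans [simp]: "norm (ctrans A) = norm A"
  unfolding norm_vec_def L2_set_def
  by (simp add: sum_nonneg) (rule sum.swap)

text \<open>Cauchy-Schwarz in each row; \<open>norm\<close> on matrices is the Frobenius
  norm.\<close>

lemma norm_matrix_vector_le: "norm (A *v x) \<le> norm A * norm x" for A :: "complex^'n^'m"
proof -
  have row: "norm ((A *v x) $ i) \<le> norm (A $ i) * norm x" for i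
  proof -
    have "norm ((A *v x) $ i) \<le> (\<Sum>j\<in>UNIV. norm (A $ i $ j) * norm (x $ j))"
      unfolding matrix_vector_mult_def by (simp add: norm_mult sum_norm_le)
    also have "\<dots> \<le> norm (A $ i) * norm x"
      unfolding norm_vec_def using L2_set_mult_ineq[of "\<lambda>j. norm (A $ i $ j)" "\<lambda>j. norm (x $ j)" UNIV]
      by simp
    finally show ?thesis .
  qed
  have "norm (A *v x) \<le> L2_set (\<lambda>i. norm (A $ i) * norm x) UNIV"
    unfolding norm_vec_def[of "A *v x"] by (rule L2_set_mono) (use row in auto)
  also have "\<dots> = norm A * norm x"
    by (simp add: norm_vec_def[of A] L2_set_left_distrib)
  finally show ?thesis .
qed

lemma norm_matrix_mult_le: "norm (A ** B) \<le> norm A * norm B" for A :: "complex^'n^'m"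
proof -
  have row: "norm ((A ** B) $ i) \<le> norm (A $ i) * norm B" for i
  proof -
    have "(A ** B) $ i = transpose B *v (A $ i)"
      by (simp add: vec_eq_iff matrix_matrix_mult_def matrix_vector_mult_def transpose_def mult.commute)
    moreover have "norm (transpose B) = norm B"
      unfolding norm_vec_def L2_set_def
      by (simp add: sum_nonneg transpose_def) (rule sum.swap)
    ultimately show ?thesis
      using norm_matrix_vector_le[of "transpose B" "A $ i"] by (simp add: mult.commute)
  qed
  have "norm (A ** B) \<le> L2_set (\<lambda>i. norm (A $ i) * norm B) UNIV"
    unfolding norm_vec_def[of "A ** B"] by (rule L2_set_mono) (use row in auto)
  also have "\<dots> = norm A * norm B"
    by (simp add: norm_vec_def[of A] L2_set_left_distrib)
  finally show ?thesis .
qed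

lemma Re_cdot_le: "Re (cdot x y) \<le> norm x * norm y"
proof -
  have "Re (cdot x y) = x \<bullet> y"
    by (simp add: cdot_def inner_vec_def inner_complex_def)
  then show ?thesis
    using norm_cauchy_schwarz[of x y] by simp
qed

lemma Re_qform_le: "Re (qform A x) \<le> norm A * (norm x)\<^sup>2"
  using Re_cdot_le[of x "A *v x"] mult_left_mono[OF norm_matrix_vector_le[of A x], of "norm x"]
  by (simp add: qform_eq_cdot power2_eq_square algebra_simps)

section \<open>Quadratic forms, semidefiniteness and congruence\<close>

lemma qform_add: "qform (A + B) x = qform A x + qform B x"
  and qform_diff: "qform (A - B) x = qform A x - qform B x"
  and qform_scaleR: "qform (c *\<^sub>R A) x = of_real c * qform A x"
  and qform_mat_1: "qform (mat 1) x = of_real ((norm x)\<^sup>2)"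
  by (simp_all add: qform_eq_cdot matrix_vector_mult_add_rdistrib matrix_vector_mult_diff_rdistrib cdot_add_right
      cdot_diff_right matrix_vector_mult_scaleR_left cdot_scaleR_right cdot_self del: of_real_power)

lemma qform_0: "qform A 0 = 0"
  by (simp add: qform_def)

lemma qform_congruence: "qform (G ** A ** ctrans G) x = qform A (ctrans G *v x)"
  by (simp add: qform_eq_cdot cdot_matrix_right ctrans_mult matrix_vector_mul_assoc matrix_mul_assoc)

lemma qform_gram: "qform (G ** ctrans G) x = of_real ((norm (ctrans G *v x))\<^sup>2)"
  using qform_congruence[of G "mat 1" x] by (simp add: qform_mat_1)

lemma hermitian_congruence: "hermitian A \<Longrightarrow> hermitian (G ** A ** ctrans G)"
  by (simp add: hermitian_def ctrans_mult matrix_mul_assoc)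

lemma pos_semidef_congruence: "pos_semidef A \<Longrightarrow> pos_semidef (G ** A ** ctrans G)"
  by (simp add: pos_semidef_def hermitian_congruence qform_congruence)

lemma pos_semidef_gram: "pos_semidef (G ** ctrans G)"
  by (simp add: pos_semidef_def hermitian_def ctrans_mult qform_gram del: of_real_power)

lemma pos_semidef_add: "pos_semidef A \<Longrightarrow> pos_semidef B \<Longrightarrow> pos_semidef (A + B)"
  by (simp add: pos_semidef_def hermitian_def ctrans_add qform_add)

lemma pos_semidef_scaleR: "pos_semidef A \<Longrightarrow> 0 \<le> c \<Longrightarrow> pos_semidef (c *\<^sub>R A)"
  by (simp add: pos_semidef_def hermitian_def ctrans_scaleR qform_scaleR)

lemma pos_def_imp_pos_semidef: "pos_def A \<Longrightarrow> pos_semidef A"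
  unfolding pos_def_def pos_semidef_def
  by (metis less_eq_real_def order_refl qform_0 zero_complex.sel(1))

lemma pos_def_add: "pos_def A \<Longrightarrow> pos_semidef B \<Longrightarrow> pos_def (A + B)"
  by (auto simp: pos_semidef_def pos_def_def hermitian_def ctrans_add qform_add intro: add_pos_nonneg)

lemma pos_def_scaleR: "pos_def A \<Longrightarrow> 0 < c \<Longrightarrow> pos_def (c *\<^sub>R A)"
  by (simp add: pos_def_def hermitian_def ctrans_scaleR qform_scaleR)

lemma pos_def_mat_1: "pos_def (mat 1)"
  by (simp add: pos_def_def hermitian_def qform_mat_1 del: of_real_power)

lemma pos_def_gram:
  assumes "\<And>x. ctrans G *v x = 0 \<Longrightarrow> x = 0"
  shows "pos_def (G ** ctrans G)"
  using assms pos_semidef_gram[of G]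
  by (auto simp: pos_def_def pos_semidef_def qform_gram simp del: of_real_power)

section \<open>Block determinants and Sylvester's identity\<close>

lemma block_nth [simp]:
  "block A B C D $ Inl a $ Inl b = A $ a $ b"
  "block A B C D $ Inl a $ Inr d = B $ a $ d"
  "block A B C D $ Inr c $ Inl b = C $ c $ b"
  "block A B C D $ Inr c $ Inr d = D $ c $ d"
  by (simp_all add: block_def)

lemma sum_UNIV_Plus:
  "(\<Sum>i\<in>(UNIV :: ('a::finite + 'b::finite) set). f i) = (\<Sum>a\<in>UNIV. f (Inl a)) + (\<Sum>b\<in>UNIV. f (Inr b))"
  by (simp add: UNIV_Plus_UNIV[symmetric] sum.Plus comp_def del: UNIV_Plus_UNIV)

lemma matrix_eq_blockI:
  assumes "\<And>a b. M $ Inl a $ Inl b = A $ a $ b" "\<And>a b. M $ Inl a $ Inr b = B $ a $ b"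
    "\<And>a b. M $ Inr a $ Inl b = C $ a $ b" "\<And>a b. M $ Inr a $ Inr b = D $ a $ b"
  shows "M = block A B C D"
  unfolding vec_eq_iff
proof (intro allI)
  fix i j
  show "M $ i $ j = block A B C D $ i $ j"
    by (cases i; cases j) (simp_all add: assms)
qed

lemma block_mult:
  "block A B C D ** block A' B' C' D' =
    block (A ** A' + B ** C') (A ** B' + B ** D') (C ** A' + D ** C') (C ** B' + D ** D')"
  by (rule matrix_eq_blockI) (simp_all add: matrix_matrix_mult_def sum_UNIV_Plus)

lemma ctrans_block: "ctrans (block A B C D) = block (ctrans A) (ctrans C) (ctrans B) (ctrans D)"
  by (rule matrix_eq_blockI) simp_all

lemma block_add: "block A B C D + block A' B' C' D' = block (A + A') (B + B') (C + C') (D + D')"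
  by (rule matrix_eq_blockI) simp_all

lemma mat_1_eq_block: "mat 1 = block (mat 1) 0 0 (mat 1)"
  by (rule matrix_eq_blockI) (simp_all add: mat_def)

text \<open>In the Leibniz sum for \<open>M\<close> only permutations fixing every index outside
  \<open>range f\<close> contribute. These are exactly the lifts along \<open>f\<close> of
  permutations of the index type of \<open>A\<close>, and lifting preserves the sign.\<close>

lemma det_extend_by_identity:
  fixes A :: "complex^'n^'n" and M :: "complex^'m^'m" and f :: "'n \<Rightarrow> 'm"
  assumes inj: "inj f"
    and M: "\<And>i j. M $ f i $ f j = A $ i $ j"
    and one: "\<And>i j. i \<notin> range f \<Longrightarrow> M $ i $ j = (if i = j then 1 else 0)"
  shows "det M = det A"
proof -
  let ?lift = "map_permutation UNIV f"
  let ?term = "\<lambda>p. of_int (sign p) * (\<Prod>i\<in>UNIV. M $ i $ p i)"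
  have bij: "bij_betw f UNIV (range f)"
    using inj by (simp add: bij_betw_def)
  have lift_f: "?lift q (f i) = f (q i)" for q i
    by (simp add: map_permutation_apply inj)
  have lift_perm: "?lift q permutes range f" if "q permutes UNIV" for q
    by (rule map_permutation_permutes[OF bij that])
  have inj_lift: "inj_on ?lift {q. q permutes UNIV}"
  proof (rule inj_onI)
    fix p q assume "?lift p = ?lift q"
    then have "f (p i) = f (q i)" for i
      using lift_f by metis
    then show "p = q"
      using inj by (auto simp: inj_eq)
  qed
  have prod_lift: "(\<Prod>i\<in>UNIV. M $ i $ ?lift q i) = (\<Prod>i\<in>UNIV. A $ i $ q i)" if q: "q permutes UNIV" for q
  proof -
    have "(\<Prod>i\<in>UNIV. M $ i $ ?lift q i) = (\<Prod>i\<in>range f. M $ i $ ?lift q i)"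
      by (rule prod.mono_neutral_right)
        (use one permutes_not_in[OF lift_perm[OF q]] in auto)
    also have "\<dots> = (\<Prod>i\<in>UNIV. M $ f i $ ?lift q (f i))"
      by (simp add: prod.reindex[OF inj])
    finally show ?thesis
      by (simp add: lift_f M)
  qed
  have zero: "?term p = 0" if p: "p permutes UNIV" and not: "p \<notin> ?lift ` {q. q permutes UNIV}" for p
  proof -
    have "\<exists>i. i \<notin> range f \<and> p i \<noteq> i"
    proof (rule ccontr)
      assume "\<not> ?thesis"
      then have fix_out: "p i = i" if "i \<notin> range f" for i
        using that by blast
      then have p': "p permutes range f"
        using p by (auto simp: permutes_def)
      \<comment> \<open>Pulling \<open>p\<close> back along the inverse of \<open>f\<close> exhibits
        it as a lift.\<close>
      let ?q = "map_permutation (range f) (inv f) p"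
      have "?q permutes UNIV"
        by (rule map_permutation_permutes[OF _ p']) (use inj in \<open>simp add: bij_betw_inv_into bij\<close>)
      moreover have "?lift ?q = p"
        by (rule map_permutation_compose_inv[OF _ p'])
          (use inj in \<open>auto simp: bij_betw_inv_into bij f_inv_into_f\<close>)
      ultimately show False
        using not by (metis image_eqI mem_Collect_eq)
    qed
    then obtain i where "i \<notin> range f" "p i \<noteq> i"
      by blast
    then have "M $ i $ p i = 0"
      using one by auto
    then show ?thesis
      by (metis (no_types, lifting) UNIV_I finite_class.finite_UNIV mult_zero_right prod_zero)
  qed
  have "det M = sum ?term (?lift ` {q. q permutes UNIV})"
    unfolding det_def
    by (rule sum.mono_neutral_right)
      (use zero permutes_subset[OF lift_perm] in \<open>auto simp: finite_permutations\<close>)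
  also have "\<dots> = (\<Sum>q\<in>{q. q permutes UNIV}. ?term (?lift q))"
    by (simp add: sum.reindex[OF inj_lift])
  also have "\<dots> = det A"
    unfolding det_def
    by (rule sum.cong) (use inj in \<open>simp_all add: prod_lift sign_map_permutation\<close>)
  finally show ?thesis .
qed

lemma det_block_diagonal: "det (block A 0 0 D) = det A * det D"
  for A :: "complex^'t^'t" and D :: "complex^'r^'r"
proof -
  have "block A 0 0 D = block A 0 0 (mat 1) ** block (mat 1) 0 0 D"
    by (simp add: block_mult)
  moreover have "det (block A 0 0 (mat 1 :: complex^'r^'r)) = det A"
  proof (rule det_extend_by_identity[of Inl])
    fix i j :: "'t + 'r"
    assume "i \<notin> range Inl"
    then show "block A 0 0 (mat 1) $ i $ j = (if i = j then 1 else 0)"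
      by (cases i; cases j) (auto simp: mat_def)
  qed simp_all
  moreover have "det (block (mat 1 :: complex^'t^'t) 0 0 D) = det D"
  proof (rule det_extend_by_identity[of Inr])
    fix i j :: "'t + 'r"
    assume "i \<notin> range Inr"
    then show "block (mat 1) 0 0 D $ i $ j = (if i = j then 1 else 0)"
      by (cases i; cases j) (auto simp: mat_def)
  qed simp_all
  ultimately show ?thesis
    by (simp add: det_mul)
qed

text \<open>The determinant \<open>d C\<close> of the unit triangular block matrix is multiplicative, so \<open>d (2 C) = (d C)\<^sup>2\<close>;
  conjugation by a diagonal matrix gives \<open>d (2 C) = d C\<close>.\<close>
lemma det_block_unit_lower: "det (block (mat 1) 0 C (mat 1)) = 1" for C :: "complex^'t^'r"
proof -
  define d where "d C = det (block (mat 1) 0 C (mat 1))" for C :: "complex^'t^'r"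
  have d_add: "d (C + C') = d C * d C'" for C C'
    unfolding d_def det_mul[symmetric] by (simp add: block_mult add.commute)
  have "d 0 = 1"
    by (simp add: d_def mat_1_eq_block[symmetric])
  then have "d C \<noteq> 0"
    using d_add[of C "- C"] by auto
  have "block (mat 1) 0 0 (c *\<^sub>R mat 1) ** block (mat 1) 0 C (mat 1) =
        block (mat 1) 0 (c *\<^sub>R C) (mat 1) ** block (mat 1) 0 0 (c *\<^sub>R mat 1)" for c :: real
    by (simp add: block_mult matrix_mult_scaleR_left)
  from arg_cong[OF this, of det "2"] have "d (2 *\<^sub>R C) = d C"
    unfolding det_mul det_block_diagonal det_scaleR d_def by simp
  then have "d (C + C) = d C"
    by (simp only: scaleR_2)
  then show ?thesis
    unfolding d_add using \<open>d C \<noteq> 0\<close> by (simp add: d_def)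
qed

lemma det_block_unit_upper: "det (block (mat 1) B 0 (mat 1)) = 1"
proof -
  have "ctrans (block (mat 1) 0 (ctrans B) (mat 1)) = block (mat 1) B 0 (mat 1)"
    by (simp add: ctrans_block)
  then show ?thesis
    by (metis complex_cnj_one det_block_unit_lower det_ctrans)
qed

lemma det_sylvester: "det (mat 1 + A ** B) = det (mat 1 + B ** A)" for A :: "complex^'n^'m"
proof -
  let ?L = "block (mat 1) 0 B (mat 1)"
  \<comment> \<open>Both sides are triangular factorizations of
    \<open>block (mat 1) (- A) B (mat 1)\<close>, one through each Schur complement, so its
    determinant is computed in two ways.\<close>
  have "?L ** (block (mat 1) 0 0 (mat 1 + B ** A) ** block (mat 1) (- A) 0 (mat 1)) =
      block (mat 1) (- A) 0 (mat 1) ** block (mat 1 + A ** B) 0 0 (mat 1) ** ?L"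
    by (simp add: block_mult matrix_add_ldistrib matrix_add_rdistrib matrix_minus_left
        matrix_minus_right matrix_mul_assoc)
  from arg_cong[OF this, of det] show ?thesis
    by (simp add: det_mul det_block_diagonal det_block_unit_lower det_block_unit_upper)
qed

section \<open>Determinants of positive definite matrices\<close>

definition outer :: "complex^'n \<Rightarrow> complex^'n^'n" where
  "outer v = (\<chi> i j. v $ i * cnj (v $ j))"

lemma outer_nth [simp]: "outer v $ i $ j = v $ i * cnj (v $ j)"
  by (simp add: outer_def)

lemma hermitian_outer: "hermitian (outer v)"
  by (simp add: hermitian_def vec_eq_iff)

lemma qform_outer: "qform (outer v) x = of_real ((cmod (cdot v x))\<^sup>2)"
proof -
  have "outer v *v x = cdot v x *s v"
    by (simp add: vec_eq_iff matrix_vector_mult_def cdot_def sum_distrib_right sum_distrib_left mult_ac)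
  then show ?thesis
    by (simp add: qform_eq_cdot cdot_scale_right complex_norm_square cnj_cdot del: of_real_power)
qed

lemma pos_semidef_outer: "pos_semidef (outer v)"
  by (simp add: pos_semidef_def hermitian_outer qform_outer del: of_real_power)

lemma outer_matrix_vector: "outer (G *v v) = G ** outer v ** ctrans G"
  by (simp add: vec_eq_iff matrix_matrix_mult_def matrix_vector_mult_def sum_distrib_left sum_distrib_right
      sum_product mult_ac)

text \<open>Allows a semidefinite matrix to be added one rank-one term at a time.\<close>

lemma gram_eq_sum_outer: "B ** ctrans B = (\<Sum>i\<in>UNIV. outer (column i B))"
  by (simp add: vec_eq_iff matrix_matrix_mult_def column_def)

section \<open>Elimination and factorization of positive semidefinite matrices\<close>

lemma hermitian_nth: "hermitian A \<Longrightarrow> cnj (A $ i $ j) = A $ j $ i"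
  unfolding hermitian_def by (metis ctrans_nth)

text \<open>The expansion behind completing the square in one coordinate: with \<open>c\<close>
  equal to the \<open>i\<close>-th entry of \<open>A *v x\<close> divided by the pivot, the result
  is the form of the eliminated matrix.\<close>

lemma qform_diff_axis:
  assumes "hermitian A"
  shows "Re (qform A (x - c *s axis i 1)) =
    Re (qform A x) - 2 * Re (cnj c * (A *v x) $ i) + (cmod c)\<^sup>2 * Re (A $ i $ i)"
proof -
  let ?e = "axis i 1 :: complex^'a"
  have e: "cdot ?e y = y $ i" for y
    by (simp add: cdot_def axis_def if_distrib if_distribR cong: if_cong)
  have ee: "(A *v ?e) $ i = A $ i $ i"
    by (simp add: matrix_vector_mult_def axis_def if_distrib cong: if_cong)
  have xe: "cdot x (A *v ?e) = cnj ((A *v x) $ i)"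
    by (metis assms cdot_hermitian cnj_cdot e)
  have "qform A (x - c *s ?e) = qform A x - (c * cnj ((A *v x) $ i) + cnj c * (A *v x) $ i) + c * cnj c * A $ i $ i"
    by (simp add: qform_eq_cdot matrix_vector_mult_diff_distrib vector_scalar_commute cdot_diff_left
        cdot_diff_right cdot_scale_left cdot_scale_right e ee xe algebra_simps)
  from arg_cong[OF this, of Re] show ?thesis
    by (simp add: cmod_power2[unfolded power2_eq_square] power2_eq_square algebra_simps)
qed

lemma pos_semidef_diag_nonneg: "pos_semidef A \<Longrightarrow> 0 \<le> Re (A $ i $ i)"
proof -
  assume A: "pos_semidef A"
  then have "0 \<le> Re (qform A (0 - 1 *s axis i 1))"
    unfolding pos_semidef_def by blast
  also have "\<dots> = Re (A $ i $ i)"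
    using A by (subst qform_diff_axis) (simp_all add: pos_semidef_def qform_0)
  finally show ?thesis .
qed

text \<open>With a zero diagonal entry the form is affine along that axis, and an affine function
  bounded below is constant.\<close>

lemma pos_semidef_diag_0_imp_row_0:
  assumes A: "pos_semidef A" and 0: "Re (A $ i $ i) = 0"
  shows "A $ i = 0"
proof -
  have "(A *v x) $ i = 0" for x
  proof (rule ccontr)
    let ?y = "(A *v x) $ i"
    assume y: "?y \<noteq> 0"
    \<comment> \<open>Chosen so that the form takes the value -1.\<close>
    define r where "r = (Re (qform A x) + 1) / (2 * (cmod ?y)\<^sup>2)"
    have "0 \<le> Re (qform A (x - (of_real r * ?y) *s axis i 1))"
      using A by (simp add: pos_semidef_def)
    also have "\<dots> = Re (qform A x) - 2 * r * (cmod ?y)\<^sup>2"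
      using A 0 by (subst qform_diff_axis) (auto simp: pos_semidef_def cmod_power2[unfolded power2_eq_square] power2_eq_square algebra_simps)
    also have "\<dots> = - 1"
      using y by (simp add: r_def field_simps)
    finally show False
      by simp
  qed
  from this[of "axis _ 1"] show ?thesis
    by (simp add: vec_eq_iff matrix_vector_mult_def axis_def if_distrib cong: if_cong)
qed

text \<open>One step of symmetric Gaussian elimination.\<close>
lemma pos_semidef_eliminate:
  assumes A: "pos_semidef A" and pos: "Re (A $ i $ i) > 0"
  defines "v \<equiv> (\<chi> k. A $ k $ i / sqrt (Re (A $ i $ i)))"
  shows "pos_semidef (A - outer v)" "(A - outer v) $ i = 0" "\<And>k. A $ k = 0 \<Longrightarrow> v $ k = 0"
proof -
  let ?a = "Re (A $ i $ i)"
  have herm: "hermitian A"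
    using A by (simp add: pos_semidef_def)
  have aii: "A $ i $ i = of_real ?a"
    using hermitian_nth[OF herm, of i i] by (metis Reals_cnj_iff of_real_Re)
  have "cdot v x = (A *v x) $ i / sqrt ?a" for x
    by (simp add: cdot_def v_def matrix_vector_mult_def hermitian_nth[OF herm] sum_divide_distrib)
  then have "Re (qform (A - outer v) x) = Re (qform A x) - (cmod ((A *v x) $ i))\<^sup>2 / ?a" for x
    using pos by (simp add: qform_diff qform_outer norm_divide power_divide del: of_real_power)
  moreover have "Re (qform A x) - (cmod ((A *v x) $ i))\<^sup>2 / ?a =
      Re (qform A (x - ((A *v x) $ i / of_real ?a) *s axis i 1))" for x
    using pos by (subst qform_diff_axis[OF herm])
      (simp add: norm_divide power_divide cmod_power2[unfolded power2_eq_square] power2_eq_square field_simps)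
  ultimately have "0 \<le> Re (qform (A - outer v) x)" for x
    using A by (simp add: pos_semidef_def)
  then show "pos_semidef (A - outer v)"
    using herm hermitian_outer[of v] by (simp add: pos_semidef_def hermitian_def ctrans_diff)
  have "v $ i * cnj (v $ k) = A $ i $ k" for k
  proof -
    have "v $ i * cnj (v $ k) = A $ i $ i * A $ i $ k / of_real (sqrt ?a * sqrt ?a)"
      unfolding of_real_mult by (simp add: v_def hermitian_nth[OF herm])
    also have "sqrt ?a * sqrt ?a = ?a"
      using pos by simp
    finally show ?thesis
      using pos by (subst (asm) aii) simp
  qed
  then show "(A - outer v) $ i = 0"
    by (simp add: vec_eq_iff)
  show "v $ k = 0" if "A $ k = 0" for k
    using that by (simp add: v_def)
qed

lemma mat_1_neq_0: "(mat 1 :: complex^'n^'n) \<noteq> 0"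
  by (auto simp: vec_eq_iff mat_def)

text \<open>Induction on the number of nonzero rows, a pivoted Cholesky decomposition. The clause on
  zero columns keeps column \<open>i\<close> of the factor of \<open>A - outer v\<close> free, so
  that the pivot vector \<open>v\<close> can be stored there.\<close>

lemma pos_semidef_factor_aux:
  assumes "pos_semidef A" and "card {i. A $ i \<noteq> 0} = n"
  shows "\<exists>B :: complex^'n^'n. A = B ** ctrans B \<and> (\<forall>i. A $ i = 0 \<longrightarrow> column i B = 0)"
  using assms
proof (induction n arbitrary: A rule: less_induct)
  case (less n A)
  show ?case
  proof (cases "A = 0")
    case True
    then show ?thesis
      by (intro exI[of _ 0]) (simp add: vec_eq_iff matrix_matrix_mult_def column_def)
  next
    case False
    then obtain i where i: "A $ i \<noteq> 0"
      by (auto simp: vec_eq_iff)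
    have pos: "Re (A $ i $ i) > 0"
      using pos_semidef_diag_nonneg[OF less.prems(1), of i] pos_semidef_diag_0_imp_row_0[OF less.prems(1), of i] i
      by fastforce
    define v where "v = (\<chi> k. A $ k $ i / sqrt (Re (A $ i $ i)))"
    note elim = pos_semidef_eliminate[OF less.prems(1) pos, folded v_def]
    have sub: "(A - outer v) $ k = 0" if "A $ k = 0" for k
      using that elim(3)[OF that] by (simp add: vec_eq_iff)
    have "card {k. (A - outer v) $ k \<noteq> 0} < n"
      unfolding less.prems(2)[symmetric]
      by (rule psubset_card_mono) (use sub elim(2) i in auto)
    from less.IH[OF this elim(1) refl] obtain B :: "complex^'n^'n"
      where B: "A - outer v = B ** ctrans B" "\<And>k. (A - outer v) $ k = 0 \<Longrightarrow> column k B = 0"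
      by blast
    define B' where "B' = (\<chi> k j. if j = i then v $ k else B $ k $ j)"
    have col: "column j B' = (if j = i then v else column j B)" for j
      by (simp add: B'_def column_def vec_eq_iff)
    have "B' ** ctrans B' = outer v + (\<Sum>j\<in>UNIV - {i}. outer (column j B))"
      by (simp add: gram_eq_sum_outer col sum.remove[of UNIV i])
    also have "(\<Sum>j\<in>UNIV - {i}. outer (column j B)) = B ** ctrans B"
      using B(2)[OF elim(2)] by (simp add: gram_eq_sum_outer sum.remove[of UNIV i]) (simp add: vec_eq_iff)
    also have "outer v + B ** ctrans B = A"
      using B(1) by (simp add: algebra_simps)
    finally show ?thesis
      using sub B(2) col i by (intro exI[of _ B']) auto
  qed
qed

lemma pos_semidef_factor:
  assumes "pos_semidef A"
  obtains B :: "complex^'n^'n" where "A = B ** ctrans B"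
  using pos_semidef_factor_aux[OF assms refl] by blast

text \<open>The form vanishes on the kernel of \<open>ctrans B\<close>, so definiteness makes the
  square factor invertible.\<close>

lemma pos_def_factor:
  fixes A :: "complex^'n^'n"
  assumes "pos_def A"
  obtains B B' :: "complex^'n^'n" where "A = B ** ctrans B" "B ** B' = mat 1" "B' ** B = mat 1"
proof -
  obtain B :: "complex^'n^'n" where B: "A = B ** ctrans B"
    by (rule pos_semidef_factor[OF pos_def_imp_pos_semidef[OF assms]])
  have "x = 0" if "ctrans B *v x = 0" for x
  proof (rule ccontr)
    assume "x \<noteq> 0"
    then have "0 < Re (qform A x)"
      using assms by (simp add: pos_def_def)
    then show False
      by (simp add: B qform_gram that)
  qed
  then obtain C where "C ** ctrans B = mat 1"
    using matrix_left_invertible_ker[of "ctrans B"] by blast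
  then have "B ** ctrans C = mat 1"
    by (metis ctrans_ctrans ctrans_mat_1 ctrans_mult)
  then show ?thesis
    using that[OF B] matrix_left_right_inverse by blast
qed

section \<open>Growth and monotonicity of the determinant\<close>

lemma pos_def_det_pos: "pos_def A \<Longrightarrow> 0 < cmod (det A)" for A :: "complex^'n^'n"
proof (erule pos_def_factor)
  fix B B' :: "complex^'n^'n"
  assume "A = B ** ctrans B" "B ** B' = mat 1"
  then show "0 < cmod (det A)"
    using det_mul[of B B'] by (auto simp: det_mul det_ctrans)
qed

text \<open>With \<open>v\<close> viewed as a one-column matrix, Sylvester's identity leaves a
  determinant of size one.\<close>

lemma det_mat_1_add_outer: "det (mat 1 + outer v) = of_real (1 + (norm v)\<^sup>2)"
proof -
  define U :: "complex^1^'a" where "U = (\<chi> i j. v $ i)"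
  have "outer v = U ** ctrans U"
    by (simp add: vec_eq_iff U_def matrix_matrix_mult_def)
  then have "det (mat 1 + outer v) = det (mat 1 + ctrans U ** U)"
    using det_sylvester[of U "ctrans U"] by simp
  also have "\<dots> = 1 + cdot v v"
    by (simp add: det_1 mat_def matrix_matrix_mult_def U_def cdot_def)
  finally show ?thesis
    by (simp add: cdot_self del: of_real_power)
qed

text \<open>For \<open>A = B ** ctrans B\<close> with inverse \<open>B'\<close> of \<open>B\<close>,
  the determinant grows exactly by the factor \<open>1 + (norm (B' *v v))\<^sup>2\<close>, and
  \<open>norm v\<close> is at most \<open>norm B\<close> times
  \<open>norm (B' *v v)\<close>.\<close>

lemma det_add_outer_ge:
  fixes A :: "complex^'n^'n"
  assumes "pos_def A"
  obtains \<epsilon> where "\<epsilon> > 0" "\<And>v. cmod (det A) * (1 + \<epsilon> * (norm v)\<^sup>2) \<le> cmod (det (A + outer v))"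
proof -
  obtain B B' :: "complex^'n^'n" where B: "A = B ** ctrans B" "B ** B' = mat 1" "B' ** B = mat 1"
    by (rule pos_def_factor[OF assms])
  have B0: "B \<noteq> 0"
    using B(2) mat_1_neq_0 by auto
  show ?thesis
  proof (rule that[of "1 / (norm B)\<^sup>2"])
    show "0 < 1 / (norm B)\<^sup>2"
      using B0 by simp
    fix v
    have v: "v = B *v (B' *v v)"
      by (simp add: matrix_vector_mul_assoc B(2))
    have "A + outer v = B ** (mat 1 + outer (B' *v v)) ** ctrans B"
      by (subst v, subst outer_matrix_vector)
        (simp add: B(1) matrix_add_ldistrib matrix_add_rdistrib)
    then have "cmod (det (A + outer v)) = cmod (det A) * (1 + (norm (B' *v v))\<^sup>2)"
      by (simp add: det_mul det_mat_1_add_outer B(1) norm_mult del: of_real_power of_real_add)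
    moreover have "(norm v)\<^sup>2 \<le> (norm B)\<^sup>2 * (norm (B' *v v))\<^sup>2"
      using power_mono[OF norm_matrix_vector_le[of B "B' *v v"] norm_ge_zero, of 2]
      unfolding v[symmetric] by (simp add: power_mult_distrib)
    then have "1 / (norm B)\<^sup>2 * (norm v)\<^sup>2 \<le> (norm (B' *v v))\<^sup>2"
      using B0 by (simp add: field_simps)
    ultimately show "cmod (det A) * (1 + 1 / (norm B)\<^sup>2 * (norm v)\<^sup>2) \<le> cmod (det (A + outer v))"
      by (simp add: mult_left_mono)
  qed
qed

text \<open>The rank-one terms of a factorization of \<open>C\<close> are added one by one; positive
  definiteness is carried along so that \<open>det_add_outer_ge\<close> applies at each
  stage.\<close>

lemma det_mono:
  fixes A :: "complex^'n^'n"
  assumes A: "pos_def A" and C: "pos_semidef C"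
  shows "cmod (det A) \<le> cmod (det (A + C))"
proof -
  obtain B :: "complex^'n^'n" where B: "C = B ** ctrans B"
    by (rule pos_semidef_factor[OF C])
  have "pos_def (A + (\<Sum>i\<in>I. outer (column i B))) \<and>
      cmod (det A) \<le> cmod (det (A + (\<Sum>i\<in>I. outer (column i B))))" if "finite I" for I
    using that
  proof induction
    case empty
    then show ?case
      using A by simp
  next
    case (insert i I)
    let ?A = "A + (\<Sum>i\<in>I. outer (column i B))"
    have eq: "A + (\<Sum>i\<in>insert i I. outer (column i B)) = ?A + outer (column i B)"
      using insert by (simp add: ac_simps)
    obtain \<epsilon> where \<epsilon>: "\<epsilon> > 0" "\<And>v. cmod (det ?A) * (1 + \<epsilon> * (norm v)\<^sup>2) \<le> cmod (det (?A + outer v))"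
      using det_add_outer_ge[OF insert.IH[THEN conjunct1]] by blast
    have "cmod (det ?A) * 1 \<le> cmod (det ?A) * (1 + \<epsilon> * (norm (column i B))\<^sup>2)"
      using \<epsilon>(1) by (intro mult_left_mono) auto
    with \<epsilon>(2)[of "column i B"] insert.IH show ?case
      unfolding eq by (auto intro: pos_def_add pos_semidef_outer)
  qed
  from this[of UNIV] show ?thesis
    by (simp add: B gram_eq_sum_outer)
qed

lemma det_mono_qform:
  assumes A: "pos_def A" and B: "hermitian B" and le: "\<And>x. Re (qform A x) \<le> Re (qform B x)"
  shows "cmod (det A) \<le> cmod (det B)"
proof -
  have "pos_semidef (B - A)"
    using A B le by (simp add: pos_semidef_def pos_def_def hermitian_def ctrans_diff qform_diff)
  from det_mono[OF A this] show ?thesis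
    by simp
qed

text \<open>As a quadratic form, \<open>A\<close> is dominated by \<open>norm A\<close> times the
  identity.\<close>

lemma det_le_norm_power:
  fixes A :: "complex^'n^'n"
  assumes "pos_def A"
  shows "cmod (det A) \<le> norm A ^ CARD('n)"
proof -
  have "cmod (det A) \<le> cmod (det (norm A *\<^sub>R (mat 1 :: complex^'n^'n)))"
    by (rule det_mono_qform[OF assms])
      (use Re_qform_le in \<open>auto simp: hermitian_def ctrans_scaleR qform_scaleR qform_mat_1 simp del: of_real_power\<close>)
  then show ?thesis
    by (simp add: det_scaleR norm_power)
qed

text \<open>A lower bound on the smallest eigenvalue, read off the factorization: \<open>x\<close>
  is recovered from \<open>ctrans B *v x\<close> by the fixed matrix
  \<open>ctrans B'\<close>.\<close>

lemma pos_def_qform_ge: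
  fixes A :: "complex^'n^'n"
  assumes "pos_def A"
  obtains \<epsilon> where "\<epsilon> > 0" "\<And>x. \<epsilon> * (norm x)\<^sup>2 \<le> Re (qform A x)"
proof -
  obtain B B' :: "complex^'n^'n" where B: "A = B ** ctrans B" "B ** B' = mat 1" "B' ** B = mat 1"
    by (rule pos_def_factor[OF assms])
  have "ctrans B' ** ctrans B = mat 1"
    by (metis B(2) ctrans_mat_1 ctrans_mult)
  then have x: "x = ctrans B' *v (ctrans B *v x)" for x
    by (simp add: matrix_vector_mul_assoc)
  have B0: "B' \<noteq> 0"
    using B(2) mat_1_neq_0 by auto
  have "(norm x)\<^sup>2 \<le> (norm B')\<^sup>2 * (norm (ctrans B *v x))\<^sup>2" for x
    using power_mono[OF norm_matrix_vector_le[of "ctrans B'" "ctrans B *v x"] norm_ge_zero, of 2]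
    unfolding x[symmetric] by (simp add: power_mult_distrib)
  then show ?thesis
    using B0 by (intro that[of "1 / (norm B')\<^sup>2"]) (simp_all add: B(1) qform_gram field_simps del: of_real_power)
qed

text \<open>Turns the power constraint into a norm bound: for \<open>A = B ** ctrans B\<close> the
  trace is the squared Frobenius norm of \<open>B\<close>.\<close>

lemma norm_le_trace:
  fixes A :: "complex^'n^'n"
  assumes "pos_semidef A"
  shows "norm A \<le> Re (trace A)"
proof -
  obtain B :: "complex^'n^'n" where B: "A = B ** ctrans B"
    by (rule pos_semidef_factor[OF assms])
  have "Re (trace A) = (norm B)\<^sup>2"
    by (simp add: B trace_def matrix_matrix_mult_def norm_vec_def L2_set_def real_sqrt_pow2 sum_nonneg
        cmod_power2[unfolded power2_eq_square] power2_eq_square)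
  then show ?thesis
    using norm_matrix_mult_le[of B "ctrans B"] by (simp add: B power2_eq_square)
qed

section \<open>The joint covariance matrix of the auxiliary and received signals\<close>

lemma qform_block_diagonal:
  "qform (block A 0 0 D) x = qform A (\<chi> a. x $ Inl a) + qform D (\<chi> b. x $ Inr b)"
  by (simp add: qform_def matrix_vector_mult_def sum_UNIV_Plus)

lemma pos_def_block_diagonal:
  assumes A: "pos_def A" and D: "pos_def D"
  shows "pos_def (block A 0 0 D)"
  unfolding pos_def_def
proof (intro conjI allI impI)
  show "hermitian (block A 0 0 D)"
    using A D by (simp add: pos_def_def hermitian_def ctrans_block)
  fix x :: "complex^('a + 'b)"
  assume x: "x \<noteq> 0"
  define u where "u = (\<chi> a. x $ Inl a)"
  define v where "v = (\<chi> b. x $ Inr b)"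
  have "u \<noteq> 0 \<or> v \<noteq> 0"
  proof (rule ccontr)
    assume "\<not> ?thesis"
    then have "x $ i = 0" for i
      by (cases i) (simp_all add: u_def v_def vec_eq_iff)
    with x show False
      by (simp add: vec_eq_iff)
  qed
  moreover have "0 \<le> Re (qform A u)" "0 \<le> Re (qform D v)"
    using pos_def_imp_pos_semidef[OF A] pos_def_imp_pos_semidef[OF D] by (simp_all add: pos_semidef_def)
  moreover have "u \<noteq> 0 \<Longrightarrow> 0 < Re (qform A u)" "v \<noteq> 0 \<Longrightarrow> 0 < Re (qform D v)"
    using A D by (simp_all add: pos_def_def)
  ultimately show "0 < Re (qform (block A 0 0 D) x)"
    by (auto simp: qform_block_diagonal u_def[symmetric] v_def[symmetric] add_pos_nonneg add_nonneg_pos)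
qed

definition stack :: "complex^'n^'t \<Rightarrow> complex^'n^'r \<Rightarrow> complex^'n^('t + 'r)" where
  "stack A B = (\<chi> i. case i of Inl a \<Rightarrow> A $ a | Inr b \<Rightarrow> B $ b)"

lemma stack_nth [simp]: "stack A B $ Inl a = A $ a" "stack A B $ Inr b = B $ b"
  by (simp_all add: stack_def)

lemma stack_congruence:
  "stack A B ** S ** ctrans (stack A B) =
    block (A ** S ** ctrans A) (A ** S ** ctrans B) (B ** S ** ctrans A) (B ** S ** ctrans B)"
  by (rule matrix_eq_blockI) (simp_all add: matrix_matrix_mult_def)

lemma norm_stack_le: "norm (stack A B) \<le> norm A + norm B"
proof -
  have "norm (stack A B) = sqrt ((norm A)\<^sup>2 + (norm B)\<^sup>2)"
    by (simp add: norm_vec_def L2_set_def sum_UNIV_Plus sum_nonneg)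
  also have "\<dots> \<le> norm A + norm B"
    by (rule sqrt_sum_squares_le_sum) auto
  finally show ?thesis .
qed

lemma norm_stack_vector_ge: "norm (B *v x) \<le> norm (stack A B *v x)"
proof -
  have "(norm (B *v x))\<^sup>2 \<le> (norm (stack A B *v x))\<^sup>2"
    by (simp add: norm_vec_def L2_set_def sum_UNIV_Plus sum_nonneg matrix_vector_mult_def)
  then show ?thesis
    by (rule power2_le_imp_le) simp
qed

text \<open>The covariance matrix of \<open>(U, Y - H U)\<close>. The interference \<open>S\<close>
  enters this pair through \<open>stack W (h ** (mat 1 - W))\<close>, while \<open>X\<close> and
  \<open>Z\<close> contribute the block diagonal part.\<close>

definition Mred :: "complex^'t^'t \<Rightarrow> complex^'t^'t \<Rightarrow> complex^'r^'r \<Rightarrow> complex^'t^'t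
    \<Rightarrow> complex^'t^'r \<Rightarrow> complex^('t + 'r)^('t + 'r)" where
  "Mred SX SS SZ W h = block SX 0 0 SZ +
     stack W (h ** (mat 1 - W)) ** SS ** ctrans (stack W (h ** (mat 1 - W)))"

text \<open>Replacing \<open>Y\<close> by \<open>Y - H U = H (1 - W) S + Z\<close> is a unimodular change of variables; it turns the
  covariance matrix of \<open>(U, Y)\<close> into the sum of that of \<open>(X, Z)\<close> and a part depending only on \<open>S\<close>.\<close>
lemma det_Mmat: "det (Mmat SX SS SZ W h) = det (Mred SX SS SZ W h)"
proof -
  have "Mmat SX SS SZ W h =
      block (mat 1) 0 h (mat 1) ** Mred SX SS SZ W h ** block (mat 1) (ctrans h) 0 (mat 1)"
    unfolding Mmat_def Mred_def stack_congruence block_add block_mult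
    by (simp add: ctrans_mult ctrans_diff matrix_add_ldistrib matrix_add_rdistrib matrix_diff_ldistrib
        matrix_diff_rdistrib matrix_mul_assoc algebra_simps)
  then show ?thesis
    by (simp add: det_mul det_block_unit_lower det_block_unit_upper)
qed

lemma pos_def_Mred:
  assumes "pos_def SX" "pos_semidef SS" "pos_def SZ"
  shows "pos_def (Mred SX SS SZ W h)"
  unfolding Mred_def by (intro pos_def_add pos_def_block_diagonal pos_semidef_congruence assms)

text \<open>Dropping the semidefinite interference term of \<open>Mred\<close> leaves the block
  diagonal part. Uniformity in \<open>W\<close> makes this a bound on the infimum in the
  rate.\<close>

lemma det_Mmat_ge:
  assumes "pos_def SX" "pos_semidef SS" "pos_def SZ"
  shows "cmod (det SX) * cmod (det SZ) \<le> cmod (det (Mmat SX SS SZ W h))"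
proof -
  have "cmod (det (block SX 0 0 SZ)) \<le> cmod (det (Mred SX SS SZ W h))"
    unfolding Mred_def by (intro det_mono pos_def_block_diagonal pos_semidef_congruence assms)
  then show ?thesis
    by (simp add: det_Mmat det_block_diagonal norm_mult)
qed

text \<open>For \<open>W = mat 1\<close> the interference no longer reaches \<open>Y - H U\<close>,
  so \<open>Mred\<close> is block diagonal and free of \<open>h\<close>.\<close>

lemma det_Mmat_mat_1: "det (Mmat SX SS SZ (mat 1) h) = det (SX + SS) * det SZ"
  unfolding det_Mmat Mred_def stack_congruence block_add
  by (simp add: det_block_diagonal)

text \<open>Polynomial growth in \<open>W\<close> and \<open>h\<close>, obtained from the norm of
  \<open>Mred\<close>; its logarithm will be the dominating function.\<close>

lemma det_Mmat_le:
  fixes SX SS :: "complex^'t^'t" and SZ :: "complex^'r^'r"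
  assumes "pos_def SX" "pos_semidef SS" "pos_def SZ"
  obtains c where "c > 0"
    "\<And>W h. cmod (det (Mmat SX SS SZ W h)) \<le> (c * (1 + norm W)\<^sup>2 * (1 + (norm h)\<^sup>2)) ^ (CARD('t) + CARD('r))"
proof -
  define n1 where "n1 = 1 + norm (mat 1 :: complex^'t^'t)"
  have n1: "n1 \<ge> 1"
    by (simp add: n1_def)
  \<comment> \<open>The factor 2 comes from
    \<open>(1 + norm h)\<^sup>2 \<le> 2 * (1 + (norm h)\<^sup>2)\<close>; the final 1 makes
    \<open>c\<close> positive.\<close>
  define c where "c = norm (block SX 0 0 SZ) + norm SS * (2 * n1\<^sup>2) + 1"
  show ?thesis
  proof (rule that[of c])
    show "c > 0"
      by (simp add: c_def add_nonneg_pos)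
    fix W and h :: "complex^'t^'r"
    let ?G = "stack W (h ** (mat 1 - W))"
    let ?q = "(1 + norm W)\<^sup>2 * (1 + (norm h)\<^sup>2)"
    have "norm (mat 1 - W) \<le> n1 * (1 + norm W)"
    proof -
      have "norm (mat 1 - W) \<le> norm (mat 1 :: complex^'t^'t) + norm W"
        by (rule norm_triangle_ineq4)
      also have "\<dots> \<le> n1 * (1 + norm W)"
        by (simp add: n1_def algebra_simps)
      finally show ?thesis .
    qed
    then have "norm (h ** (mat 1 - W)) \<le> norm h * (n1 * (1 + norm W))"
      using norm_matrix_mult_le[of h "mat 1 - W"] by (meson mult_left_mono norm_ge_zero order_trans)
    moreover have "norm W \<le> n1 * (1 + norm W)"
      using n1 mult_mono[of 1 n1 "norm W" "1 + norm W"] by simp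
    ultimately have "norm ?G \<le> n1 * (1 + norm W) * (1 + norm h)"
      using norm_stack_le[of W "h ** (mat 1 - W)"] by (simp add: algebra_simps)
    then have "(norm ?G)\<^sup>2 \<le> (n1 * (1 + norm W) * (1 + norm h))\<^sup>2"
      by (rule power_mono) simp
    also have "\<dots> = n1\<^sup>2 * (1 + norm W)\<^sup>2 * (1 + norm h)\<^sup>2"
      by (simp add: power_mult_distrib)
    also have "\<dots> \<le> n1\<^sup>2 * (1 + norm W)\<^sup>2 * (2 * (1 + (norm h)\<^sup>2))"
    proof (rule mult_left_mono)
      show "(1 + norm h)\<^sup>2 \<le> 2 * (1 + (norm h)\<^sup>2)"
        using sum_squares_bound[of 1 "norm h"] by (simp add: power2_eq_square algebra_simps)
    qed simp
    finally have G: "(norm ?G)\<^sup>2 \<le> 2 * n1\<^sup>2 * ?q"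
      by (simp only: mult_ac)
    have q: "1 \<le> ?q"
      using mult_mono[of 1 "(1 + norm W)\<^sup>2" 1 "1 + (norm h)\<^sup>2"] by (simp add: one_le_power)
    have "norm (?G ** SS ** ctrans ?G) \<le> norm (?G ** SS) * norm ?G"
      using norm_matrix_mult_le[of "?G ** SS" "ctrans ?G"] by simp
    also have "\<dots> \<le> norm ?G * norm SS * norm ?G"
      by (intro mult_right_mono norm_matrix_mult_le) simp
    also have "\<dots> \<le> norm SS * (2 * n1\<^sup>2 * ?q)"
      using mult_left_mono[OF G norm_ge_zero[of SS]] by (simp add: power2_eq_square mult_ac)
    finally have "norm (Mred SX SS SZ W h) \<le> norm (block SX 0 0 SZ) + norm SS * (2 * n1\<^sup>2 * ?q)"
      unfolding Mred_def using norm_triangle_ineq[of "block SX 0 0 SZ" "?G ** SS ** ctrans ?G"] by linarith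
    also have "\<dots> \<le> c * ?q"
    proof -
      have "norm (block SX 0 0 SZ) \<le> norm (block SX 0 0 SZ) * ?q"
        using mult_left_mono[OF q norm_ge_zero[of "block SX 0 0 SZ"]] by simp
      then show ?thesis
        using q by (simp add: c_def distrib_right mult_ac)
    qed
    finally have "norm (Mred SX SS SZ W h) \<le> c * (1 + norm W)\<^sup>2 * (1 + (norm h)\<^sup>2)"
      by (simp add: mult_ac)
    then have "norm (Mred SX SS SZ W h) ^ CARD('t + 'r) \<le> (c * (1 + norm W)\<^sup>2 * (1 + (norm h)\<^sup>2)) ^ CARD('t + 'r)"
      by (rule power_mono) simp
    then show "cmod (det (Mmat SX SS SZ W h)) \<le> (c * (1 + norm W)\<^sup>2 * (1 + (norm h)\<^sup>2)) ^ (CARD('t) + CARD('r))"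
      using det_le_norm_power[OF pos_def_Mred[OF assms, of W h]] by (simp add: det_Mmat)
  qed
qed

lemma pos_semidef_sum_outer: "finite I \<Longrightarrow> pos_semidef (\<Sum>i\<in>I. outer (f i))"
proof (induction rule: finite_induct)
  case empty
  show ?case
    by (simp add: pos_semidef_def hermitian_def qform_def)
qed (simp add: pos_semidef_add pos_semidef_outer)

text \<open>A counterpart to the upper bound: for a suitable \<open>W\<close> the determinant
  controls column \<open>i\<close> of \<open>h\<close>. Here \<open>mat 1 - W\<close> sends a
  nonzero column \<open>b\<close> of a factor of \<open>SS\<close> to the \<open>i\<close>-th axis
  vector, so the rank-one part of the interference along \<open>b\<close> carries column
  \<open>i\<close> of \<open>h\<close>.\<close>

lemma det_Mmat_ge_column:
  fixes SX SS :: "complex^'t^'t" and SZ :: "complex^'r^'r"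
  assumes SX: "pos_def SX" and SS: "pos_semidef SS" "SS \<noteq> 0" and SZ: "pos_def SZ"
  obtains W \<epsilon> where "\<epsilon> > 0"
    "\<And>h. cmod (det SX) * cmod (det SZ) * (1 + \<epsilon> * (norm (column i h))\<^sup>2) \<le> cmod (det (Mmat SX SS SZ W h))"
proof -
  obtain B :: "complex^'t^'t" where B: "SS = B ** ctrans B"
    by (rule pos_semidef_factor[OF SS(1)])
  with SS(2) have "B \<noteq> 0"
    by auto
  then obtain j where "column j B \<noteq> 0"
    by (auto simp: vec_eq_iff column_def)
  define b where "b = column j B"
  define R where "R = (\<Sum>k\<in>UNIV - {j}. outer (column k B))"
  have b: "norm b > 0"
    using \<open>column j B \<noteq> 0\<close> by (simp add: b_def)
  have SS_eq: "SS = outer b + R"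
    by (simp add: B gram_eq_sum_outer R_def b_def sum.remove[of UNIV j])
  \<comment> \<open>The rank-one map sending \<open>b\<close> to the \<open>i\<close>-th axis
    vector.\<close>
  define N :: "complex^'t^'t" where "N = (\<chi> k l. if k = i then cnj (b $ l) / of_real ((norm b)\<^sup>2) else 0)"
  define W where "W = mat 1 - N"
  have "N *v b = axis i (cdot b b / of_real ((norm b)\<^sup>2))"
    by (simp add: vec_eq_iff N_def matrix_vector_mult_def axis_def cdot_def sum_divide_distrib)
  then have Nb: "N *v b = axis i 1"
    using b by (simp add: cdot_self del: of_real_power)
  have D: "pos_def (block SX 0 0 SZ)"
    by (rule pos_def_block_diagonal[OF SX SZ])
  obtain \<epsilon> where \<epsilon>: "\<epsilon> > 0"
    "\<And>v. cmod (det (block SX 0 0 SZ)) * (1 + \<epsilon> * (norm v)\<^sup>2) \<le> cmod (det (block SX 0 0 SZ + outer v))"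
    using det_add_outer_ge[OF D] by blast
  show ?thesis
  proof (rule that[of \<epsilon> W, OF \<epsilon>(1)])
    fix h :: "complex^'t^'r"
    define G where "G = stack W (h ** (mat 1 - W))"
    have "(h ** N) *v b = column i h"
      by (simp add: matrix_vector_mul_assoc[symmetric] Nb)
        (simp add: vec_eq_iff matrix_vector_mult_def axis_def column_def if_distrib cong: if_cong)
    then have "norm (column i h) \<le> norm (G *v b)"
      using norm_stack_vector_ge[of "h ** (mat 1 - W)" b W] by (simp add: G_def W_def)
    then have "(norm (column i h))\<^sup>2 \<le> (norm (G *v b))\<^sup>2"
      by (rule power_mono) simp
    then have "cmod (det (block SX 0 0 SZ)) * (1 + \<epsilon> * (norm (column i h))\<^sup>2)
        \<le> cmod (det (block SX 0 0 SZ)) * (1 + \<epsilon> * (norm (G *v b))\<^sup>2)"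
      using \<epsilon>(1) by (simp add: mult_left_mono)
    also have "\<dots> \<le> cmod (det (block SX 0 0 SZ + outer (G *v b)))"
      by (rule \<epsilon>(2))
    also have "\<dots> \<le> cmod (det (block SX 0 0 SZ + outer (G *v b) + G ** R ** ctrans G))"
      unfolding R_def
      by (intro det_mono pos_def_add D pos_semidef_outer pos_semidef_congruence pos_semidef_sum_outer) simp
    also have "block SX 0 0 SZ + outer (G *v b) + G ** R ** ctrans G = Mred SX SS SZ W h"
      unfolding Mred_def G_def[symmetric] SS_eq outer_matrix_vector
      by (simp add: matrix_add_ldistrib matrix_add_rdistrib)
    finally show "cmod (det SX) * cmod (det SZ) * (1 + \<epsilon> * (norm (column i h))\<^sup>2)
        \<le> cmod (det (Mmat SX SS SZ W h))"
      by (simp add: det_Mmat det_block_diagonal norm_mult)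
  qed
qed

section \<open>Bounds for the determinant of the received covariance matrix\<close>

lemma det_mat_1_add_gram_le:
  fixes h :: "complex^'t^'r"
  assumes "s \<ge> 0"
  shows "cmod (det (mat 1 + s *\<^sub>R (h ** ctrans h))) \<le>
    (norm (mat 1 :: complex^'r^'r) + s * (norm h)\<^sup>2) ^ CARD('r)"
proof -
  have "norm (mat 1 + s *\<^sub>R (h ** ctrans h)) \<le> norm (mat 1 :: complex^'r^'r) + s * norm (h ** ctrans h)"
    using norm_triangle_ineq[of "mat 1" "s *\<^sub>R (h ** ctrans h)"] assms by simp
  also have "\<dots> \<le> norm (mat 1 :: complex^'r^'r) + s * (norm h)\<^sup>2"
    using norm_matrix_mult_le[of h "ctrans h"] assms by (simp add: power2_eq_square mult_left_mono)
  finally have "norm (mat 1 + s *\<^sub>R (h ** ctrans h)) ^ CARD('r) \<le>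
      (norm (mat 1 :: complex^'r^'r) + s * (norm h)\<^sup>2) ^ CARD('r)"
    by (rule power_mono) simp
  moreover have "pos_def (mat 1 + s *\<^sub>R (h ** ctrans h))"
    by (intro pos_def_add pos_def_mat_1 pos_semidef_scaleR pos_semidef_gram assms)
  ultimately show ?thesis
    using det_le_norm_power order_trans by blast
qed

text \<open>Lets the Gram estimates be applied in the smaller of the two dimensions, which produces
  the exponent \<open>min CARD('t) CARD('r)\<close>.\<close>

lemma det_mat_1_add_gram_swap:
  "det (mat 1 + s *\<^sub>R (h ** ctrans h)) = det (mat 1 + s *\<^sub>R (ctrans h ** h))"
  using det_sylvester[of "s *\<^sub>R h" "ctrans h"]
  by (simp add: matrix_mult_scaleR_left matrix_mult_scaleR_right)

text \<open>Both \<open>Q\<close> and \<open>SZ\<close> are dominated by multiples of the identity,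
  which reduces the claim to the determinant of \<open>mat 1\<close> plus a multiple of
  \<open>h ** ctrans h\<close>.\<close>

lemma det_receive_le:
  fixes SZ :: "complex^'r^'r"
  assumes SZ: "pos_def SZ"
  obtains k a where "k > 0" "a > 0"
    "\<And>Q s (h :: complex^'t^'r). pos_semidef Q \<Longrightarrow> norm Q \<le> s \<Longrightarrow>
      cmod (det (h ** Q ** ctrans h + SZ)) \<le> k * (a + s / norm SZ * (norm h)\<^sup>2) ^ min CARD('t) CARD('r)"
proof -
  define \<kappa> where "\<kappa> = norm SZ"
  \<comment> \<open>Exceeds the norms of both identity matrices, so one constant serves both cases
    of the minimum.\<close>
  define a where "a = norm (mat 1 :: complex^'t^'t) + norm (mat 1 :: complex^'r^'r)"
  have "SZ \<noteq> 0"
  proof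
    assume "SZ = 0"
    then have "0 < Re (qform SZ (axis undefined 1))"
      using SZ by (simp add: pos_def_def)
    then show False
      by (simp add: \<open>SZ = 0\<close> qform_def)
  qed
  then have \<kappa>: "\<kappa> > 0"
    by (simp add: \<kappa>_def)
  show ?thesis
  proof (rule that[of "\<kappa> ^ CARD('r)" a])
    show "0 < \<kappa> ^ CARD('r)" "0 < a"
      using \<kappa> by (simp_all add: a_def mat_1_neq_0 add_pos_pos)
    fix Q :: "complex^'t^'t" and s and h :: "complex^'t^'r"
    assume Q: "pos_semidef Q" "norm Q \<le> s"
    then have s: "s / \<kappa> \<ge> 0"
      using \<kappa> norm_ge_zero[of Q] by (intro divide_nonneg_pos) linarith+
    have "Re (qform (h ** Q ** ctrans h + SZ) x) \<le> s * (norm (ctrans h *v x))\<^sup>2 + \<kappa> * (norm x)\<^sup>2" for x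
      using Re_qform_le[of Q "ctrans h *v x"] mult_right_mono[OF Q(2), of "(norm (ctrans h *v x))\<^sup>2"]
        Re_qform_le[of SZ x]
      by (simp add: qform_add qform_congruence \<kappa>_def)
    also have "s * (norm (ctrans h *v x))\<^sup>2 + \<kappa> * (norm x)\<^sup>2 =
        Re (qform (\<kappa> *\<^sub>R (mat 1 + (s / \<kappa>) *\<^sub>R (h ** ctrans h))) x)" for x
      using \<kappa> by (simp add: qform_scaleR qform_add qform_mat_1 qform_gram field_simps del: of_real_power)
    finally have "cmod (det (h ** Q ** ctrans h + SZ)) \<le>
        cmod (det (\<kappa> *\<^sub>R (mat 1 + (s / \<kappa>) *\<^sub>R (h ** ctrans h))))"
      using pos_def_add[OF SZ pos_semidef_congruence[OF Q(1)]]
      by (intro det_mono_qform)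
        (simp_all add: add.commute hermitian_def ctrans_scaleR ctrans_add ctrans_mult)
    also have "\<dots> = \<kappa> ^ CARD('r) * cmod (det (mat 1 + (s / \<kappa>) *\<^sub>R (h ** ctrans h)))"
      using \<kappa> by (simp add: det_scaleR norm_mult norm_power)
    also have "\<dots> \<le> \<kappa> ^ CARD('r) * (a + s / \<kappa> * (norm h)\<^sup>2) ^ min CARD('t) CARD('r)"
    proof (rule mult_left_mono)
      have sh: "0 \<le> s / \<kappa> * (norm h)\<^sup>2"
        by (rule mult_nonneg_nonneg[OF s zero_le_power2])
      show "cmod (det (mat 1 + (s / \<kappa>) *\<^sub>R (h ** ctrans h))) \<le> (a + s / \<kappa> * (norm h)\<^sup>2) ^ min CARD('t) CARD('r)"
      proof (cases "CARD('t) \<le> CARD('r)")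
        case True
        have "cmod (det (mat 1 + (s / \<kappa>) *\<^sub>R (h ** ctrans h))) \<le>
            (norm (mat 1 :: complex^'t^'t) + s / \<kappa> * (norm h)\<^sup>2) ^ CARD('t)"
          using det_mat_1_add_gram_le[OF s, of "ctrans h"] by (simp add: det_mat_1_add_gram_swap)
        also have "\<dots> \<le> (a + s / \<kappa> * (norm h)\<^sup>2) ^ CARD('t)"
          using sh by (intro power_mono) (simp_all add: a_def)
        finally show ?thesis
          using True by (simp add: min_def)
      next
        case False
        have "cmod (det (mat 1 + (s / \<kappa>) *\<^sub>R (h ** ctrans h))) \<le>
            (norm (mat 1 :: complex^'r^'r) + s / \<kappa> * (norm h)\<^sup>2) ^ CARD('r)"
          by (rule det_mat_1_add_gram_le[OF s])
        also have "\<dots> \<le> (a + s / \<kappa> * (norm h)\<^sup>2) ^ CARD('r)"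
          using sh by (intro power_mono) (simp_all add: a_def)
        finally show ?thesis
          using False by (simp add: min_def)
      qed
    qed (use \<kappa> in simp)
    finally show "cmod (det (h ** Q ** ctrans h + SZ)) \<le>
        \<kappa> ^ CARD('r) * (a + s / norm SZ * (norm h)\<^sup>2) ^ min CARD('t) CARD('r)"
      by (simp add: \<kappa>_def)
  qed
qed

lemma det_mat_1_add_gram_ge:
  fixes h :: "complex^'t^'r"
  assumes s: "s > 0" and h: "pos_def (h ** ctrans h)"
  shows "s ^ CARD('r) * cmod (det (h ** ctrans h)) \<le> cmod (det (mat 1 + s *\<^sub>R (h ** ctrans h)))"
  using det_mono[OF pos_def_scaleR[OF h s] pos_def_imp_pos_semidef[OF pos_def_mat_1]] s
  by (simp add: det_scaleR norm_mult norm_power add.commute)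

section \<open>Full rank and the Gram determinant\<close>

lemma pos_def_gram_columns:
  fixes h :: "complex^'t^'r"
  assumes "rank h = CARD('t)"
  shows "pos_def (ctrans h ** h)"
proof -
  have "vec.span (rows h) = UNIV"
    using assms vec.dim_eq_full[of "rows h"] by (simp add: row_rank_def_gen vec.dimension_def card_cart_basis)
  then have "\<And>x. h *v x = 0 \<Longrightarrow> x = 0"
    using matrix_left_invertible_span_rows_gen[of h] matrix_left_invertible_ker[of h] by blast
  then show ?thesis
    using pos_def_gram[of "ctrans h"] by simp
qed

lemma pos_def_gram_rows:
  fixes h :: "complex^'t^'r"
  assumes rank: "rank h = CARD('r)"
  shows "pos_def (h ** ctrans h)"
proof -
  have rows: "rows h = range (\<lambda>i. row i h)"
    by (auto simp: rows_def)
  then have fin: "finite (rows h)"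
    by simp
  \<comment> \<open>\<open>rows h\<close> is a set, so coinciding rows must be excluded before its
    independence says anything about the indexed family of rows.\<close>
  have "CARD('r) \<le> card (rows h)"
    using rank vec.dim_le_card'[of "rows h"] by (simp add: row_rank_def_gen rows)
  then have card: "card (rows h) = CARD('r)"
    using card_image_le[of UNIV "\<lambda>i. row i h"] by (simp add: rows)
  then have inj: "inj (\<lambda>i. row i h)"
    unfolding rows by (simp add: eq_card_imp_inj_on)
  have indep: "vec.independent (rows h)"
    using rank card by (intro vec.card_le_dim_spanning[of _ "vec.span (rows h)"])
      (simp_all add: row_rank_def_gen vec.span_superset rows)
  have "c i = 0" if "(\<Sum>i\<in>UNIV. c i *s row i h) = 0" for c i
  proof -
    have "(\<Sum>v\<in>rows h. c (inv (\<lambda>i. row i h) v) *s v) = 0"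
      using that inv_f_f[OF inj] by (simp add: rows sum.reindex[OF inj])
    then have "\<forall>v\<in>rows h. c (inv (\<lambda>i. row i h) v) = 0"
      using vec.independentD[OF indep fin order_refl, of "\<lambda>v. c (inv (\<lambda>i. row i h) v)"] by blast
    then show ?thesis
      using inv_f_f[OF inj] by (simp add: rows)
  qed
  then obtain B where "h ** B = mat 1"
    using matrix_right_invertible_independent_rows[of h] by blast
  then have "ctrans B ** ctrans h = mat 1"
    by (metis ctrans_mat_1 ctrans_mult)
  then show ?thesis
    using matrix_left_invertible_ker[of "ctrans h"] by (intro pos_def_gram) blast
qed

lemma pos_def_gram_if_det_nonzero:
  assumes "det (G ** ctrans G) \<noteq> 0"
  shows "pos_def (G ** ctrans G)"
proof (rule pos_def_gram)
  fix x
  assume "ctrans G *v x = 0"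
  then have "(G ** ctrans G) *v x = 0"
    by (simp add: matrix_vector_mul_assoc[symmetric])
  then show "x = 0"
    using assms invertible_det_nz[of "G ** ctrans G"] invertible_left_inverse[of "G ** ctrans G"]
      matrix_left_invertible_ker[of "G ** ctrans G"] by blast
qed

text \<open>Full rank is used only through the nonvanishing of this determinant, whose measurability is immediate.\<close>
definition gram_det :: "complex^'t^'r \<Rightarrow> complex" where
  "gram_det h = (if CARD('t) \<le> CARD('r) then det (ctrans h ** h) else det (h ** ctrans h))"

lemma gram_det_nonzero:
  fixes h :: "complex^'t^'r"
  assumes "rank h = min CARD('t) CARD('r)"
  shows "gram_det h \<noteq> 0"
  using assms pos_def_gram_columns[of h] pos_def_gram_rows[of h] pos_def_det_pos[of "ctrans h ** h"]
    pos_def_det_pos[of "h ** ctrans h"] by (auto simp: gram_det_def min_def split: if_splits)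

text \<open>Mirror image of \<open>det_receive_le\<close>: \<open>Q\<close> and \<open>SZ\<close>
  are bounded below by multiples of the identity, and then the identity summand is dropped.\<close>

lemma det_receive_ge:
  fixes SZ :: "complex^'r^'r"
  assumes SZ: "pos_def SZ"
  obtains c where "c > 0"
    "\<And>Q s (h :: complex^'t^'r). hermitian Q \<Longrightarrow> s > 0 \<Longrightarrow> (\<And>x. s * (norm x)\<^sup>2 \<le> Re (qform Q x)) \<Longrightarrow>
      gram_det h \<noteq> 0 \<Longrightarrow>
      c * s ^ min CARD('t) CARD('r) * cmod (gram_det h) \<le> cmod (det (h ** Q ** ctrans h + SZ))"
proof -
  let ?m = "min CARD('t) CARD('r)"
  obtain \<epsilon> where \<epsilon>: "\<epsilon> > 0" "\<And>x. \<epsilon> * (norm x)\<^sup>2 \<le> Re (qform SZ x)"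
    using pos_def_qform_ge[OF SZ] by blast
  show ?thesis
  \<comment> \<open>The numerator comes from scaling a matrix of size \<open>CARD('r)\<close>, the
    denominator from the power of \<open>s / \<epsilon>\<close>.\<close>
  proof (rule that[of "\<epsilon> ^ CARD('r) / \<epsilon> ^ ?m"])
    show "\<epsilon> ^ CARD('r) / \<epsilon> ^ ?m > 0"
      using \<epsilon>(1) by simp
    fix Q :: "complex^'t^'t" and s and h :: "complex^'t^'r"
    assume Q: "hermitian Q" and s: "s > 0" and ge: "\<And>x. s * (norm x)\<^sup>2 \<le> Re (qform Q x)"
      and nz: "gram_det h \<noteq> 0"
    have s\<epsilon>: "s / \<epsilon> > 0"
      using s \<epsilon>(1) by simp
    have "(s / \<epsilon>) ^ ?m * cmod (gram_det h) \<le> cmod (det (mat 1 + (s / \<epsilon>) *\<^sub>R (h ** ctrans h)))"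
    proof (cases "CARD('t) \<le> CARD('r)")
      case True
      then have "pos_def (ctrans h ** h)"
        using nz pos_def_gram_if_det_nonzero[of "ctrans h"] by (simp add: gram_det_def)
      then show ?thesis
        using det_mat_1_add_gram_ge[OF s\<epsilon>, of "ctrans h"] True
        by (simp add: det_mat_1_add_gram_swap gram_det_def min_def)
    next
      case False
      then have "pos_def (h ** ctrans h)"
        using nz pos_def_gram_if_det_nonzero[of h] by (simp add: gram_det_def)
      then show ?thesis
        using det_mat_1_add_gram_ge[OF s\<epsilon>, of h] False by (simp add: gram_det_def min_def)
    qed
    then have "\<epsilon> ^ CARD('r) * ((s / \<epsilon>) ^ ?m * cmod (gram_det h)) \<le>
        \<epsilon> ^ CARD('r) * cmod (det (mat 1 + (s / \<epsilon>) *\<^sub>R (h ** ctrans h)))"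
      using \<epsilon>(1) by (intro mult_left_mono) auto
    also have "\<dots> = cmod (det (\<epsilon> *\<^sub>R (mat 1 + (s / \<epsilon>) *\<^sub>R (h ** ctrans h))))"
      using \<epsilon>(1) by (simp add: det_scaleR norm_mult norm_power)
    also have "\<dots> \<le> cmod (det (h ** Q ** ctrans h + SZ))"
    proof (rule det_mono_qform)
      show "pos_def (\<epsilon> *\<^sub>R (mat 1 + (s / \<epsilon>) *\<^sub>R (h ** ctrans h)))"
        using s\<epsilon> by (intro pos_def_scaleR pos_def_add pos_def_mat_1 pos_semidef_scaleR pos_semidef_gram \<epsilon>(1)) simp
      show "hermitian (h ** Q ** ctrans h + SZ)"
        using hermitian_congruence[OF Q, of h] SZ by (simp add: pos_def_def hermitian_def ctrans_add)
      fix x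
      have "Re (qform (\<epsilon> *\<^sub>R (mat 1 + (s / \<epsilon>) *\<^sub>R (h ** ctrans h))) x) =
          s * (norm (ctrans h *v x))\<^sup>2 + \<epsilon> * (norm x)\<^sup>2"
        using \<epsilon>(1) by (simp add: qform_scaleR qform_add qform_mat_1 qform_gram field_simps del: of_real_power)
      then show "Re (qform (\<epsilon> *\<^sub>R (mat 1 + (s / \<epsilon>) *\<^sub>R (h ** ctrans h))) x) \<le> Re (qform (h ** Q ** ctrans h + SZ) x)"
        using ge[of "ctrans h *v x"] \<epsilon>(2)[of x] by (simp add: qform_add qform_congruence)
    qed
    finally show "\<epsilon> ^ CARD('r) / \<epsilon> ^ ?m * s ^ ?m * cmod (gram_det h) \<le> cmod (det (h ** Q ** ctrans h + SZ))"
      by (simp add: power_divide)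
  qed
qed

section \<open>Integrability and continuity in the inflation factor\<close>

lemma continuous_on_det:
  "continuous_on S f \<Longrightarrow> continuous_on S (\<lambda>x. det (f x))" for f :: "'a::topological_space \<Rightarrow> complex^'n^'n"
  unfolding det_def by (intro continuous_intros)

lemma continuous_on_matrix_mult:
  "continuous_on S f \<Longrightarrow> continuous_on S g \<Longrightarrow> continuous_on S (\<lambda>x. f x ** g x)"
  for f :: "'a::topological_space \<Rightarrow> complex^'n^'m"
  unfolding matrix_matrix_mult_def by (intro continuous_intros)

lemma continuous_on_ctrans: "continuous_on S f \<Longrightarrow> continuous_on S (\<lambda>x. ctrans (f x))"
  unfolding ctrans_def by (intro continuous_intros)

lemma continuous_on_block:
  assumes "continuous_on S A" "continuous_on S B" "continuous_on S C" "continuous_on S D"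
  shows "continuous_on S (\<lambda>x. block (A x) (B x) (C x) (D x))"
  unfolding block_def
proof (intro continuous_on_vec_lambda)
  fix i j
  show "continuous_on S (\<lambda>x. case i of Inl a \<Rightarrow> (case j of Inl b \<Rightarrow> A x $ a $ b | Inr b \<Rightarrow> B x $ a $ b)
      | Inr a \<Rightarrow> (case j of Inl b \<Rightarrow> C x $ a $ b | Inr b \<Rightarrow> D x $ a $ b))"
    by (cases i; cases j) (simp_all, (intro continuous_intros assms)+)
qed

lemma continuous_on_Mmat:
  "continuous_on S W \<Longrightarrow> continuous_on S h \<Longrightarrow> continuous_on S (\<lambda>x. Mmat SX SS SZ (W x) (h x))"
  unfolding Mmat_def
  by (intro continuous_on_block continuous_on_add continuous_on_matrix_mult continuous_on_ctrans continuous_on_const)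

lemma borel_measurable_logdet:
  assumes "continuous_on UNIV f"
  shows "(\<lambda>x. logdet (f x)) \<in> borel_measurable borel"
proof -
  have [measurable]: "(\<lambda>x. det (f x)) \<in> borel_measurable borel"
    by (rule borel_measurable_continuous_onI[OF continuous_on_det[OF assms]])
  show ?thesis
    unfolding logdet_def by measurable
qed

lemma borel_measurable_logdet_Mmat [measurable]: "(\<lambda>h. logdet (Mmat SX SS SZ W h)) \<in> borel_measurable borel"
  by (intro borel_measurable_logdet continuous_on_Mmat continuous_on_const continuous_on_id)

lemma borel_measurable_logdet_receive [measurable]:
  "(\<lambda>h. logdet (h ** Q ** ctrans h + SZ)) \<in> borel_measurable borel"
  by (intro borel_measurable_logdet continuous_on_add continuous_on_matrix_mult continuous_on_ctrans
      continuous_on_const continuous_on_id)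

lemma logdet_scaleR: "c > 0 \<Longrightarrow> det A \<noteq> 0 \<Longrightarrow> logdet (c *\<^sub>R A) = CARD('n) * ln c + logdet A"
  for A :: "complex^'n^'n"
  by (simp add: logdet_def det_scaleR norm_mult norm_power ln_mult_pos ln_realpow)

lemma logdet_Mmat_ge:
  assumes "pos_def SX" "pos_semidef SS" "pos_def SZ"
  shows "logdet SX + logdet SZ \<le> logdet (Mmat SX SS SZ W h)"
proof -
  have pos: "0 < cmod (det SX)" "0 < cmod (det SZ)"
    using assms by (simp_all only: pos_def_det_pos)
  then have "logdet SX + logdet SZ = ln (cmod (det SX) * cmod (det SZ))"
    by (simp add: logdet_def ln_mult_pos)
  also have "\<dots> \<le> logdet (Mmat SX SS SZ W h)"
    unfolding logdet_def using pos by (intro ln_mono det_Mmat_ge assms mult_pos_pos)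
  finally show ?thesis .
qed

lemma det_Mmat_pos:
  assumes "pos_def SX" "pos_semidef SS" "pos_def SZ"
  shows "0 < cmod (det (Mmat SX SS SZ W h))"
  by (simp only: det_Mmat pos_def_det_pos[OF pos_def_Mred[OF assms]])

text \<open>A majorant that is uniform for bounded \<open>W\<close> and integrable in
  \<open>h\<close> as soon as \<open>ln (1 + (norm h)\<^sup>2)\<close> is.\<close>

lemma logdet_Mmat_le:
  fixes SX SS :: "complex^'t^'t" and SZ :: "complex^'r^'r"
  assumes "pos_def SX" "pos_semidef SS" "pos_def SZ"
  obtains c where "\<And>W h. logdet (Mmat SX SS SZ W h) \<le>
    (CARD('t) + CARD('r)) * (c + 2 * ln (1 + norm W) + ln (1 + (norm h)\<^sup>2))"
proof -
  obtain c where c: "c > 0"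
    "\<And>W h. cmod (det (Mmat SX SS SZ W h)) \<le> (c * (1 + norm W)\<^sup>2 * (1 + (norm h)\<^sup>2)) ^ (CARD('t) + CARD('r))"
    using det_Mmat_le[OF assms] by blast
  show ?thesis
  proof (rule that[of "ln c"])
    fix W :: "complex^'t^'t" and h :: "complex^'t^'r"
    have pos: "0 < 1 + norm W" "0 < 1 + (norm h)\<^sup>2"
      by (simp_all add: add_pos_nonneg)
    have "logdet (Mmat SX SS SZ W h) \<le> ln ((c * (1 + norm W)\<^sup>2 * (1 + (norm h)\<^sup>2)) ^ (CARD('t) + CARD('r)))"
      unfolding logdet_def by (rule ln_mono[OF c(2) det_Mmat_pos[OF assms]])
    also have "\<dots> = (CARD('t) + CARD('r)) * (ln c + 2 * ln (1 + norm W) + ln (1 + (norm h)\<^sup>2))"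
      using c(1) pos by (simp add: ln_realpow ln_mult_pos)
    finally show "logdet (Mmat SX SS SZ W h) \<le>
        (CARD('t) + CARD('r)) * (ln c + 2 * ln (1 + norm W) + ln (1 + (norm h)\<^sup>2))" .
  qed
qed

lemma integrable_logdet_Mmat:
  fixes SX SS :: "complex^'t^'t" and SZ :: "complex^'r^'r"
  assumes pd: "pos_def SX" "pos_semidef SS" "pos_def SZ"
    and N: "prob_space N" and [measurable_cong]: "sets N = sets borel"
    and int: "integrable N (\<lambda>h. ln (1 + (norm h)\<^sup>2))"
  shows "integrable N (\<lambda>h. logdet (Mmat SX SS SZ W h))"
proof -
  interpret prob_space N by (rule N)
  obtain c where c: "\<And>W h. logdet (Mmat SX SS SZ W h) \<le>
      (CARD('t) + CARD('r)) * (c + 2 * ln (1 + norm W) + ln (1 + (norm h)\<^sup>2))"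
    using logdet_Mmat_le[OF pd] by blast
  let ?u = "\<lambda>h. (CARD('t) + CARD('r)) * (c + 2 * ln (1 + norm W) + ln (1 + (norm h)\<^sup>2))"
  show ?thesis
  proof (rule Bochner_Integration.integrable_bound)
    show "integrable N (\<lambda>h. \<bar>?u h\<bar> + \<bar>logdet SX + logdet SZ\<bar>)"
      using int by simp
    show "AE h in N. norm (logdet (Mmat SX SS SZ W h)) \<le> norm (\<bar>?u h\<bar> + \<bar>logdet SX + logdet SZ\<bar>)"
      using c[of W] logdet_Mmat_ge[OF pd, of W] by (intro AE_I2) (smt (verit) real_norm_def)
  qed measurable
qed

text \<open>Dominated convergence along sequences: a convergent sequence of inflation factors is
  bounded by some \<open>R\<close>, which gives one majorant for all its terms.\<close>

lemma continuous_integral_logdet_Mmat: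
  fixes SX SS :: "complex^'t^'t" and SZ :: "complex^'r^'r"
  assumes pd: "pos_def SX" "pos_semidef SS" "pos_def SZ"
    and N: "prob_space N" and [measurable_cong]: "sets N = sets borel"
    and int: "integrable N (\<lambda>h. ln (1 + (norm h)\<^sup>2))"
  shows "continuous_on UNIV (\<lambda>W. \<integral>h. logdet (Mmat SX SS SZ W h) \<partial>N)"
  unfolding continuous_on_sequentially
proof (intro allI ballI impI, elim conjE)
  fix X and W :: "complex^'t^'t"
  assume X: "X \<longlonglongrightarrow> W"
  interpret prob_space N by (rule N)
  obtain c where c: "\<And>W h. logdet (Mmat SX SS SZ W h) \<le>
      (CARD('t) + CARD('r)) * (c + 2 * ln (1 + norm W) + ln (1 + (norm h)\<^sup>2))"
    using logdet_Mmat_le[OF pd] by blast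
  from X obtain R where R: "\<And>n. norm (X n) \<le> R"
    using convergent_imp_Bseq[of X] by (auto simp: convergent_def Bseq_def)
  have R0: "0 \<le> R"
    using R[of 0] norm_ge_zero order_trans by blast
  let ?u = "\<lambda>h. (CARD('t) + CARD('r)) * (c + 2 * ln (1 + R) + ln (1 + (norm h)\<^sup>2))"
  have "(\<lambda>n. \<integral>h. logdet (Mmat SX SS SZ (X n) h) \<partial>N) \<longlonglongrightarrow> (\<integral>h. logdet (Mmat SX SS SZ W h) \<partial>N)"
  proof (rule integral_dominated_convergence[where w = "\<lambda>h. \<bar>?u h\<bar> + \<bar>logdet SX + logdet SZ\<bar>"])
    show "integrable N (\<lambda>h. \<bar>?u h\<bar> + \<bar>logdet SX + logdet SZ\<bar>)"
      using int by simp
    have "(\<lambda>n. det (Mmat SX SS SZ (X n) h)) \<longlonglongrightarrow> det (Mmat SX SS SZ W h)" for h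
      using continuous_on_tendsto_compose[OF _ X, of UNIV "\<lambda>W. det (Mmat SX SS SZ W h)"]
      by (simp add: continuous_on_det continuous_on_Mmat)
    then have "(\<lambda>n. logdet (Mmat SX SS SZ (X n) h)) \<longlonglongrightarrow> logdet (Mmat SX SS SZ W h)" for h
      unfolding logdet_def using det_Mmat_pos[OF pd, of W h] by (intro tendsto_ln tendsto_norm) auto
    then show "AE h in N. (\<lambda>n. logdet (Mmat SX SS SZ (X n) h)) \<longlonglongrightarrow> logdet (Mmat SX SS SZ W h)"
      by simp
    fix n
    have "logdet (Mmat SX SS SZ (X n) h) \<le> ?u h" for h
    proof -
      have "ln (1 + norm (X n)) \<le> ln (1 + R)"
        using R[of n] by (intro ln_mono) (auto simp: add_pos_nonneg R0)
      then have "(CARD('t) + CARD('r)) * (c + 2 * ln (1 + norm (X n)) + ln (1 + (norm h)\<^sup>2)) \<le> ?u h"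
        by (intro mult_left_mono) auto
      with c[of "X n" h] show ?thesis
        by linarith
    qed
    then show "AE h in N. norm (logdet (Mmat SX SS SZ (X n) h)) \<le> \<bar>?u h\<bar> + \<bar>logdet SX + logdet SZ\<bar>"
      using logdet_Mmat_ge[OF pd, of "X n"] by (intro AE_I2) (smt (verit) real_norm_def)
  qed measurable
  then show "((\<lambda>W. \<integral>h. logdet (Mmat SX SS SZ W h) \<partial>N) \<circ> X) \<longlonglongrightarrow> (\<integral>h. logdet (Mmat SX SS SZ W h) \<partial>N)"
    by (simp add: comp_def)
qed

text \<open>The set where \<open>f\<close> is at least its infimum over \<open>C\<close> is closed
  and contains \<open>C\<close>, hence is everything.\<close>

lemma INF_continuous_dense:
  fixes f :: "'a::topological_space \<Rightarrow> real"
  assumes cont: "continuous_on UNIV f" and dense: "closure C = UNIV" and bdd: "bdd_below (range f)"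
  shows "(INF x. f x) = (INF x\<in>C. f x)"
proof -
  have C: "C \<noteq> {}"
    using dense by auto
  have bdd': "bdd_below (f ` C)"
    using bdd by (rule bdd_below_mono) auto
  have "closed {x. (INF x\<in>C. f x) \<le> f x}"
    by (intro closed_Collect_le continuous_on_const cont)
  moreover have "C \<subseteq> {x. (INF x\<in>C. f x) \<le> f x}"
    using cINF_lower[OF bdd'] by auto
  ultimately have "closure C \<subseteq> {x. (INF x\<in>C. f x) \<le> f x}"
    by (rule closure_minimal[rotated])
  then have "(INF x\<in>C. f x) \<le> (INF x. f x)"
    using dense by (intro cINF_greatest) auto
  moreover have "(INF x. f x) \<le> (INF x\<in>C. f x)"
    using C bdd by (intro cINF_superset_mono) auto
  ultimately show ?thesis
    by simp
qed

lemma ln_one_plus_sum_le: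
  assumes "finite I" "\<And>i. i \<in> I \<Longrightarrow> 0 \<le> y i"
  shows "ln (1 + (\<Sum>i\<in>I. y i)) \<le> (\<Sum>i\<in>I. ln (1 + y i :: real))"
  using assms
proof induction
  case (insert i I)
  have nn: "0 \<le> y i" "0 \<le> (\<Sum>i\<in>I. y i)"
    using insert.prems by (auto intro: sum_nonneg)
  have "ln (1 + (\<Sum>i\<in>insert i I. y i)) \<le> ln ((1 + y i) * (1 + (\<Sum>i\<in>I. y i)))"
    using insert nn by (intro ln_mono) (auto simp: algebra_simps add_pos_nonneg)
  also have "\<dots> = ln (1 + y i) + ln (1 + (\<Sum>i\<in>I. y i))"
    using nn by (intro ln_mult_pos) auto
  finally show ?case
    using insert by auto
qed simp

text \<open>One inflation factor per column of \<open>h\<close>, taken from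
  \<open>det_Mmat_ge_column\<close>; summing over columns bounds the norm. Used contrapositively: if
  the logarithm of the norm is not integrable, some \<open>W\<close> has a non-integrable
  log-determinant.\<close>

lemma integrable_ln_norm_if_integrable_logdet_Mmat:
  fixes SX SS :: "complex^'t^'t" and SZ :: "complex^'r^'r"
  assumes SX: "pos_def SX" and SS: "pos_semidef SS" "SS \<noteq> 0" and SZ: "pos_def SZ"
    and N: "prob_space N" and [measurable_cong]: "sets N = sets borel"
    and int: "\<And>W. integrable N (\<lambda>h. logdet (Mmat SX SS SZ W h))"
  shows "integrable N (\<lambda>h. ln (1 + (norm h)\<^sup>2))"
proof -
  interpret prob_space N by (rule N)
  have "\<exists>W \<epsilon>. \<epsilon> > 0 \<and> (\<forall>h. cmod (det SX) * cmod (det SZ) * (1 + \<epsilon> * (norm (column i h))\<^sup>2)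
      \<le> cmod (det (Mmat SX SS SZ W h)))" for i
    using det_Mmat_ge_column[OF SX SS SZ, of i] by metis
  then obtain W \<epsilon> where \<epsilon>: "\<And>i. \<epsilon> i > 0" and W: "\<And>i h. cmod (det SX) * cmod (det SZ) *
      (1 + \<epsilon> i * (norm (column i h))\<^sup>2) \<le> cmod (det (Mmat SX SS SZ (W i) h))"
    by metis
  define g where "g h = (\<Sum>i\<in>UNIV. ln (1 + 1 / \<epsilon> i) + (logdet (Mmat SX SS SZ (W i) h) - logdet SX - logdet SZ))" for h
  have g: "integrable N g"
    unfolding g_def using int by simp
  have "ln (1 + (norm h)\<^sup>2) \<le> g h" for h :: "complex^'t^'r"
  proof -
    have "(norm h)\<^sup>2 = (\<Sum>i\<in>UNIV. (norm (column i h))\<^sup>2)"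
      by (simp add: norm_vec_def L2_set_def sum_nonneg column_def) (rule sum.swap)
    then have "ln (1 + (norm h)\<^sup>2) \<le> (\<Sum>i\<in>UNIV. ln (1 + (norm (column i h))\<^sup>2))"
      using ln_one_plus_sum_le[of UNIV "\<lambda>i. (norm (column i h))\<^sup>2"] by simp
    also have "\<dots> \<le> g h"
      unfolding g_def
    proof (rule sum_mono)
      fix i
      let ?y = "(norm (column i h))\<^sup>2"
      have \<epsilon>y: "0 < 1 + \<epsilon> i * ?y" "0 < 1 + 1 / \<epsilon> i"
        using \<epsilon>[of i] by (simp_all add: add_pos_nonneg)
      have "ln (1 + ?y) \<le> ln ((1 + 1 / \<epsilon> i) * (1 + \<epsilon> i * ?y))"
        using \<epsilon>[of i] \<epsilon>y by (intro ln_mono mult_pos_pos) (auto simp: field_simps add_pos_nonneg)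
      also have "\<dots> = ln (1 + 1 / \<epsilon> i) + ln (1 + \<epsilon> i * ?y)"
        using \<epsilon>y by (intro ln_mult_pos)
      finally have 1: "ln (1 + ?y) \<le> ln (1 + 1 / \<epsilon> i) + ln (1 + \<epsilon> i * ?y)" .
      have pos: "0 < cmod (det SX)" "0 < cmod (det SZ)"
        using SX SZ by (simp_all only: pos_def_det_pos)
      have "logdet SX + logdet SZ + ln (1 + \<epsilon> i * ?y) = ln (cmod (det SX) * cmod (det SZ) * (1 + \<epsilon> i * ?y))"
        using pos \<epsilon>y by (simp add: logdet_def ln_mult_pos)
      also have "\<dots> \<le> logdet (Mmat SX SS SZ (W i) h)"
        unfolding logdet_def using W[of i h] pos \<epsilon>y det_Mmat_pos[OF SX SS(1) SZ, of "W i" h]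
        by (intro ln_mono mult_pos_pos)
      finally show "ln (1 + ?y) \<le> ln (1 + 1 / \<epsilon> i) + (logdet (Mmat SX SS SZ (W i) h) - logdet SX - logdet SZ)"
        using 1 by linarith
    qed
    finally show ?thesis .
  qed
  then have bound: "AE h in N. norm (ln (1 + (norm h)\<^sup>2)) \<le> norm (g h)"
    by (intro AE_I2) (smt (verit) real_norm_def ln_ge_zero zero_le_power2)
  have "(\<lambda>h. ln (1 + (norm h)\<^sup>2)) \<in> borel_measurable N"
    by measurable
  with g show ?thesis
    by (rule Bochner_Integration.integrable_bound) (rule bound)
qed

text \<open>A non-integrable \<open>f\<close> has Bochner integral 0, and nonnegativity of
  \<open>g\<close> covers that case. The upper bound thus holds for every \<open>SX\<close>, whether
  or not the conditional rate is integrable.\<close>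

lemma integral_le_nonneg_majorant:
  fixes f g :: "'a \<Rightarrow> real"
  assumes "integrable M g" "AE x in M. f x \<le> g x" "AE x in M. 0 \<le> g x"
  shows "(\<integral>x. f x \<partial>M) \<le> (\<integral>x. g x \<partial>M)"
proof (cases "integrable M f")
  case True
  then show ?thesis
    using assms by (intro integral_mono_AE)
next
  case False
  then show ?thesis
    using assms(3) by (simp add: not_integrable_integral_eq integral_nonneg_AE)
qed

section \<open>Rate bounds\<close>

lemma countable_closure_eq_UNIV:
  obtains C :: "'a::second_countable_topology set" where "countable C" "closure C = UNIV"
proof -
  obtain C :: "'a set" where C: "countable C" "\<And>X. open X \<Longrightarrow> X \<noteq> {} \<Longrightarrow> \<exists>d\<in>C. d \<in> X"
    by (rule countable_dense_setE) blast
  have "closure C = UNIV"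
  proof (rule ccontr)
    assume "closure C \<noteq> UNIV"
    then have "\<exists>d\<in>C. d \<in> - closure C"
      by (intro C(2)) auto
    then show False
      using closure_subset by blast
  qed
  with C(1) show ?thesis
    by (rule that)
qed

locale fading_channel =
  fixes mu :: "'b measure"
    and K :: "'b \<Rightarrow> (complex^'t^'r) measure"
    and SZ :: "complex^'r^'r"
    and SS' :: "complex^'t^'t"
    and m :: nat
  assumes mu_prob: "prob_space mu"
    and K_meas [measurable]: "K \<in> measurable mu (subprob_algebra borel)"
    and K_prob: "\<And>b. b \<in> space mu \<Longrightarrow> prob_space (K b)"
    and full_rank: "AE h in (mu \<bind> K). rank h = m"
    and frob: "integrable (mu \<bind> K) (\<lambda>h. (norm h)\<^sup>2)"
    and logdet_int_le: "CARD('t) \<le> CARD('r) \<Longrightarrow>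
                   integrable (mu \<bind> K) (\<lambda>h. logdet (ctrans h ** h))"
    and logdet_int_gt: "CARD('t) > CARD('r) \<Longrightarrow>
                   integrable (mu \<bind> K) (\<lambda>h. logdet (h ** ctrans h))"
    and SZ_pd: "pos_def SZ"
    and SS'_psd: "pos_semidef SS'"
    and m_eq: "m = min CARD('t) CARD('r)"
begin

sublocale mu: prob_space mu
  by (rule mu_prob)

lemma sets_K: "b \<in> space mu \<Longrightarrow> sets (K b) = sets borel"
  using K_meas by (rule sets_kernel)

lemma borel_measurable_K: "f \<in> borel_measurable borel \<Longrightarrow> b \<in> space mu \<Longrightarrow> f \<in> borel_measurable (K b)"
  using measurable_cong_sets[OF sets_K refl] by blast

lemma integral_K_measurable:
  fixes f :: "complex^'t^'r \<Rightarrow> real"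
  assumes "f \<in> borel_measurable borel"
  shows "(\<lambda>b. \<integral>h. f h \<partial>K b) \<in> borel_measurable mu"
  by (rule measurable_compose[OF K_meas integral_measurable_subprob_algebra[OF assms]])

text \<open>Tonelli for the mixture \<open>mu \<bind> K\<close>: passes from the joint moment
  conditions to almost every conditional law.\<close>

lemma integrable_bind_nonneg:
  fixes v :: "complex^'t^'r \<Rightarrow> real"
  assumes v: "v \<in> borel_measurable borel" "\<And>h. 0 \<le> v h" and int: "integrable (mu \<bind> K) v"
  shows "AE b in mu. integrable (K b) v" "integrable mu (\<lambda>b. \<integral>h. v h \<partial>K b)"
proof -
  let ?I = "\<lambda>b. \<integral>\<^sup>+h. ennreal (v h) \<partial>K b"
  have ev: "(\<lambda>h. ennreal (v h)) \<in> borel_measurable borel"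
    using v(1) by simp
  have meas: "?I \<in> borel_measurable mu"
    by (rule measurable_compose[OF K_meas nn_integral_measurable_subprob_algebra[OF ev]])
  have "(\<integral>\<^sup>+b. ?I b \<partial>mu) = (\<integral>\<^sup>+h. ennreal (v h) \<partial>(mu \<bind> K))"
    by (rule nn_integral_bind[OF ev K_meas, symmetric])
  also have "\<dots> < \<infinity>"
    using int v(2) by (simp add: integrable_iff_bounded)
  finally have fin: "(\<integral>\<^sup>+b. ?I b \<partial>mu) < \<infinity>" .
  then have "AE b in mu. ?I b \<noteq> \<infinity>"
    by (intro nn_integral_noteq_infinite meas) auto
  then show int_K: "AE b in mu. integrable (K b) v"
    using AE_space
  proof eventually_elim
    case (elim b)
    then show ?case
      using v borel_measurable_K by (auto simp: integrable_iff_bounded less_top)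
  qed
  have "(\<integral>\<^sup>+b. ennreal (norm (\<integral>h. v h \<partial>K b)) \<partial>mu) = (\<integral>\<^sup>+b. ?I b \<partial>mu)"
    using int_K by (intro nn_integral_cong_AE) (auto simp: v(2) nn_integral_eq_integral integral_nonneg_AE)
  then show "integrable mu (\<lambda>b. \<integral>h. v h \<partial>K b)"
    using fin integral_K_measurable[OF v(1)] by (simp add: integrable_iff_bounded)
qed

lemma integrable_ln_norm:
  assumes "b \<in> space mu" "integrable (K b) (\<lambda>h. (norm h)\<^sup>2)"
  shows "integrable (K b) (\<lambda>h. ln (1 + (norm h)\<^sup>2))"
proof (rule Bochner_Integration.integrable_bound[OF assms(2)])
  show "(\<lambda>h. ln (1 + (norm h)\<^sup>2)) \<in> borel_measurable (K b)"
    by (intro borel_measurable_K assms) measurable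
  show "AE h in K b. norm (ln (1 + (norm h)\<^sup>2)) \<le> norm ((norm h)\<^sup>2)"
    by (intro AE_I2) (simp add: ln_add_one_self_le_self)
qed

text \<open>Bochner integrals of non-integrable functions are \<open>0\<close>. When all integrands are nonnegative this makes
  the infimum equal to \<open>0\<close> as soon as one of them is not integrable, and otherwise the integral is
  continuous in \<open>W\<close>.\<close>
lemma INF_logdet_measurable:
  fixes SX SS :: "complex^'t^'t"
  assumes SX: "pos_def SX" and SS: "pos_semidef SS" and nonneg: "0 \<le> logdet SX + logdet SZ"
  shows "(\<lambda>b. INF W. \<integral>h. logdet (Mmat SX SS SZ W h) \<partial>K b) \<in> borel_measurable mu"
proof -
  define I where "I W b = (\<integral>h. logdet (Mmat SX SS SZ W h) \<partial>K b)" for W b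
  have I_meas [measurable]: "I W \<in> borel_measurable mu" for W
    unfolding I_def by (rule integral_K_measurable) measurable
  have I_nonneg: "0 \<le> I W b" for W b
    unfolding I_def using logdet_Mmat_ge[OF SX SS SZ_pd, of W] nonneg
    by (intro Bochner_Integration.integral_nonneg) (meson order_trans)
  have bdd: "bdd_below (range (\<lambda>W. I W b))" for b
    by (rule bdd_belowI[of _ 0]) (auto simp: I_nonneg)
  have eln: "(\<lambda>h :: complex^'t^'r. ennreal (ln (1 + (norm h)\<^sup>2))) \<in> borel_measurable borel"
    by measurable
  have [measurable]: "(\<lambda>b. \<integral>\<^sup>+h. ennreal (ln (1 + (norm h)\<^sup>2)) \<partial>K b) \<in> borel_measurable mu"
    by (rule measurable_compose[OF K_meas nn_integral_measurable_subprob_algebra[OF eln]])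
  define D where "D b \<longleftrightarrow> (\<integral>\<^sup>+h. ennreal (ln (1 + (norm h)\<^sup>2)) \<partial>K b) < \<infinity>" for b
  have D_iff: "D b \<longleftrightarrow> integrable (K b) (\<lambda>h. ln (1 + (norm h)\<^sup>2))" if "b \<in> space mu" for b
    using borel_measurable_K[OF _ that, of "\<lambda>h. ln (1 + (norm h)\<^sup>2)"] unfolding D_def
    by (simp add: integrable_iff_bounded)
  obtain C :: "(complex^'t^'t) set" where C: "countable C" "closure C = UNIV"
    by (rule countable_closure_eq_UNIV)
  \<comment> \<open>If \<open>SS = 0\<close>, the matrix \<open>Mmat\<close> does not depend on
    \<open>W\<close>, so the infimum is its value at 0 whether or not the integrand is
    integrable.\<close>
  define F where "F b = (if D b then INF W\<in>C. I W b else if SS = 0 then I 0 b else 0)" for b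
  have "F \<in> borel_measurable mu"
    unfolding F_def D_def using C by (intro measurable_If borel_measurable_cINF_real) auto
  moreover have "(INF W. I W b) = F b" if b: "b \<in> space mu" for b
  proof (cases "D b")
    case True
    then show ?thesis
      using INF_continuous_dense[OF continuous_integral_logdet_Mmat[OF SX SS SZ_pd K_prob[OF b] sets_K[OF b]]
          C(2), folded I_def] D_iff[OF b] bdd by (simp add: F_def)
  next
    case False
    show ?thesis
    proof (cases "SS = 0")
      case True
      then have const: "(\<lambda>W. I W b) = (\<lambda>_. I 0 b)"
        by (simp add: I_def Mmat_def fun_eq_iff)
      have "(INF W. I W b) = I 0 b"
        unfolding const by (rule cINF_const[OF UNIV_not_empty])
      then show ?thesis
        using False True by (simp add: F_def)
    next
      case nz: False
      then obtain W where "\<not> integrable (K b) (\<lambda>h. logdet (Mmat SX SS SZ W h))"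
        using integrable_ln_norm_if_integrable_logdet_Mmat[OF SX SS _ SZ_pd K_prob[OF b] sets_K[OF b]]
          D_iff[OF b] False by blast
      then have "I W b = 0"
        by (simp add: I_def not_integrable_integral_eq)
      then have "(INF W. I W b) \<le> 0"
        using cINF_lower[OF bdd, of W b] by simp
      moreover have "0 \<le> (INF W. I W b)"
        using I_nonneg by (intro cINF_greatest) auto
      ultimately show ?thesis
        using False nz by (simp add: F_def)
    qed
  qed
  ultimately show ?thesis
    unfolding I_def[symmetric] using measurable_cong[of mu "\<lambda>b. INF W. I W b" F borel] by blast
qed

section \<open>Upper bound for the conditional and the averaged rate\<close>

definition rate_at :: "complex^'t^'t \<Rightarrow> complex^'t^'t \<Rightarrow> 'b \<Rightarrow> real" where
  "rate_at SS SX b = (\<integral>h. logdet SX + logdet (h ** (SX + SS) ** ctrans h + SZ) \<partial>K b)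
     - (INF W. \<integral>h. logdet (Mmat SX SS SZ W h) \<partial>K b)"

lemma dpc_rate_eq: "dpc_rate mu K SZ SS SX = (\<integral>b. rate_at SS SX b \<partial>mu)"
  by (simp add: dpc_rate_def rate_at_def)

lemma logdet_receive_ge: "pos_semidef Q \<Longrightarrow> logdet SZ \<le> logdet (h ** Q ** ctrans h + SZ)"
  unfolding logdet_def add.commute[of _ SZ]
  by (intro ln_mono det_mono pos_def_det_pos SZ_pd pos_semidef_congruence)

lemma pos_semidef_signal: "pos_def SX \<Longrightarrow> 0 \<le> P \<Longrightarrow> pos_semidef (SX + P *\<^sub>R SS')"
  by (intro pos_semidef_add pos_def_imp_pos_semidef pos_semidef_scaleR[OF SS'_psd])

text \<open>Uniform over all admissible \<open>SX\<close>, since the trace constraint bounds the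
  norm of \<open>SX + P *\<^sub>R SS'\<close> by a multiple of \<open>P\<close>. Factoring out
  \<open>P\<close> gives the leading term.\<close>

lemma logdet_receive_le:
  obtains c q where "c \<ge> 0" "q \<ge> 0"
    "\<And>P SX (h :: complex^'t^'r). P \<ge> 1 \<Longrightarrow> pos_def SX \<Longrightarrow> Re (trace SX) \<le> P \<Longrightarrow>
      logdet (h ** (SX + P *\<^sub>R SS') ** ctrans h + SZ) \<le> m * ln P + c + q * (norm h)\<^sup>2"
proof -
  obtain k a where ka: "k > 0" "a > 0" and le:
    "\<And>Q s (h :: complex^'t^'r). pos_semidef Q \<Longrightarrow> norm Q \<le> s \<Longrightarrow>
      cmod (det (h ** Q ** ctrans h + SZ)) \<le> k * (a + s / norm SZ * (norm h)\<^sup>2) ^ m"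
    unfolding m_eq by (rule det_receive_le[OF SZ_pd]) blast
  define q where "q = (1 + norm SS') / norm SZ"
  have q: "q \<ge> 0"
    by (simp add: q_def)
  show ?thesis
  proof (rule that[of "\<bar>ln k\<bar> + m * a" "m * q"])
    show "0 \<le> \<bar>ln k\<bar> + m * a" "0 \<le> m * q"
      using ka q by simp_all
    fix P :: real and SX :: "complex^'t^'t" and h :: "complex^'t^'r"
    assume P: "P \<ge> 1" and SX: "pos_def SX" and tr: "Re (trace SX) \<le> P"
    define Q where "Q = SX + P *\<^sub>R SS'"
    have Q: "pos_semidef Q"
      unfolding Q_def using P by (intro pos_semidef_signal SX) simp
    have "norm Q \<le> norm SX + P * norm SS'"
      unfolding Q_def using norm_triangle_ineq[of SX "P *\<^sub>R SS'"] P by simp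
    also have "\<dots> \<le> P * (1 + norm SS')"
      using norm_le_trace[OF pos_def_imp_pos_semidef[OF SX]] tr by (simp add: algebra_simps)
    finally have nQ: "norm Q \<le> P * (1 + norm SS')" .
    let ?z = "a + q * (norm h)\<^sup>2"
    have z: "0 < ?z"
      using ka q by (simp add: add_pos_nonneg)
    have "P * (1 + norm SS') / norm SZ * (norm h)\<^sup>2 = P * (q * (norm h)\<^sup>2)"
      by (simp add: q_def)
    then have "a + P * (1 + norm SS') / norm SZ * (norm h)\<^sup>2 \<le> P * ?z"
      using mult_right_mono[of 1 P a] P ka by (simp only: distrib_left) simp
    then have "(a + P * (1 + norm SS') / norm SZ * (norm h)\<^sup>2) ^ m \<le> (P * ?z) ^ m"
      using P ka by (intro power_mono) (auto intro!: add_nonneg_nonneg)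
    then have "cmod (det (h ** Q ** ctrans h + SZ)) \<le> k * (P * ?z) ^ m"
      using le[OF Q nQ, of h] ka(1) by (meson mult_left_mono less_imp_le order_trans)
    moreover have "0 < cmod (det (h ** Q ** ctrans h + SZ))"
      using pos_def_det_pos[OF pos_def_add[OF SZ_pd pos_semidef_congruence[OF Q]]] by (simp add: add.commute)
    ultimately have "logdet (h ** Q ** ctrans h + SZ) \<le> ln (k * (P * ?z) ^ m)"
      unfolding logdet_def by (rule ln_mono)
    also have "\<dots> = ln k + m * (ln P + ln ?z)"
      using ka P z by (simp add: ln_mult_pos ln_realpow)
    \<comment> \<open>The remaining logarithm is bounded linearly, to match the second moment
      assumed for the fading matrix.\<close>
    also have "\<dots> \<le> \<bar>ln k\<bar> + m * (ln P + ?z)"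
      using ln_le_minus_one[OF z] by (intro add_mono mult_left_mono) auto
    also have "\<dots> = m * ln P + (\<bar>ln k\<bar> + m * a) + m * q * (norm h)\<^sup>2"
      by (simp add: algebra_simps)
    finally show "logdet (h ** (SX + P *\<^sub>R SS') ** ctrans h + SZ)
        \<le> m * ln P + (\<bar>ln k\<bar> + m * a) + m * q * (norm h)\<^sup>2"
      by (simp add: Q_def)
  qed
qed

lemma integrable_logdet_receive:
  assumes b: "b \<in> space mu" and int: "integrable (K b) (\<lambda>h. (norm h)\<^sup>2)"
    and P: "P \<ge> 1" and SX: "pos_def SX" and tr: "Re (trace SX) \<le> P"
  shows "integrable (K b) (\<lambda>h. logdet (h ** (SX + P *\<^sub>R SS') ** ctrans h + SZ))"
proof -
  interpret Kb: prob_space "K b"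
    by (rule K_prob[OF b])
  obtain c q where c: "c \<ge> 0" "q \<ge> 0" and le:
    "\<And>h :: complex^'t^'r. logdet (h ** (SX + P *\<^sub>R SS') ** ctrans h + SZ) \<le> m * ln P + c + q * (norm h)\<^sup>2"
    using logdet_receive_le P SX tr by metis
  have Q: "pos_semidef (SX + P *\<^sub>R SS')"
    using P by (intro pos_semidef_signal SX) simp
  show ?thesis
  proof (rule Bochner_Integration.integrable_bound)
    show "integrable (K b) (\<lambda>h. \<bar>m * ln P + c + q * (norm h)\<^sup>2\<bar> + \<bar>logdet SZ\<bar>)"
      using int by simp
    show "(\<lambda>h. logdet (h ** (SX + P *\<^sub>R SS') ** ctrans h + SZ)) \<in> borel_measurable (K b)"
      by (intro borel_measurable_K borel_measurable_logdet_receive b)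
    show "AE h in K b. norm (logdet (h ** (SX + P *\<^sub>R SS') ** ctrans h + SZ))
        \<le> norm (\<bar>m * ln P + c + q * (norm h)\<^sup>2\<bar> + \<bar>logdet SZ\<bar>)"
      using le logdet_receive_ge[OF Q] by (intro AE_I2) (smt (verit) real_norm_def)
  qed
qed

lemma AE_integrable_norm: "AE b in mu. integrable (K b) (\<lambda>h. (norm h)\<^sup>2)"
  and integrable_integral_norm: "integrable mu (\<lambda>b. \<integral>h. (norm h)\<^sup>2 \<partial>K b)"
  by (rule integrable_bind_nonneg[OF _ _ frob]; simp)+

text \<open>The terms \<open>logdet SX\<close> from the received signal and from the lower bound on
  the infimum cancel. \<open>G\<close> is the same for all \<open>P\<close> and
  \<open>SX\<close>.\<close>

lemma rate_at_le:
  obtains G where "\<And>P b. P \<ge> 1 \<Longrightarrow> 0 \<le> m * ln P + G b" "integrable mu G"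
    "\<And>P SX. P \<ge> 1 \<Longrightarrow> pos_def SX \<Longrightarrow> Re (trace SX) \<le> P \<Longrightarrow>
      AE b in mu. rate_at (P *\<^sub>R SS') SX b \<le> m * ln P + G b"
proof -
  obtain c q where cq: "c \<ge> 0" "q \<ge> 0" and le:
    "\<And>P SX (h :: complex^'t^'r). P \<ge> 1 \<Longrightarrow> pos_def SX \<Longrightarrow> Re (trace SX) \<le> P \<Longrightarrow>
      logdet (h ** (SX + P *\<^sub>R SS') ** ctrans h + SZ) \<le> m * ln P + c + q * (norm h)\<^sup>2"
    by (rule logdet_receive_le) blast
  \<comment> \<open>The absolute value stands in for \<open>- logdet SZ\<close> to keep the majorant
    nonnegative, as \<open>integral_le_nonneg_majorant\<close> requires.\<close>
  define G where "G b = c + q * (\<integral>h. (norm h)\<^sup>2 \<partial>K b) + \<bar>logdet SZ\<bar>" for b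
  show ?thesis
  proof (rule that[of G])
    show "0 \<le> m * ln P + G b" if "P \<ge> 1" for P b
      using cq that by (simp add: G_def)
    show "integrable mu G"
      unfolding G_def using integrable_integral_norm by simp
    fix P :: real and SX :: "complex^'t^'t"
    assume P: "P \<ge> 1" and SX: "pos_def SX" and tr: "Re (trace SX) \<le> P"
    have SS: "pos_semidef (P *\<^sub>R SS')"
      using P SS'_psd by (intro pos_semidef_scaleR) auto
    show "AE b in mu. rate_at (P *\<^sub>R SS') SX b \<le> m * ln P + G b"
      using AE_integrable_norm AE_space
    proof eventually_elim
      case (elim b)
      interpret Kb: prob_space "K b"
        by (rule K_prob[OF elim(2)])
      have "(\<integral>h. logdet SX + logdet (h ** (SX + P *\<^sub>R SS') ** ctrans h + SZ) \<partial>K b)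
          \<le> (\<integral>h. logdet SX + (m * ln P + c + q * (norm h)\<^sup>2) \<partial>K b)"
        using integrable_logdet_receive[OF elim(2,1) P SX tr] elim(1) le[OF P SX tr]
        by (intro integral_mono) auto
      also have "\<dots> = logdet SX + m * ln P + c + q * (\<integral>h. (norm h)\<^sup>2 \<partial>K b)"
        using elim(1) by (simp add: Kb.prob_space)
      finally have 1: "(\<integral>h. logdet SX + logdet (h ** (SX + P *\<^sub>R SS') ** ctrans h + SZ) \<partial>K b)
          \<le> logdet SX + m * ln P + c + q * (\<integral>h. (norm h)\<^sup>2 \<partial>K b)" .
      have "logdet SX + logdet SZ \<le> (\<integral>h. logdet (Mmat SX (P *\<^sub>R SS') SZ W h) \<partial>K b)" for W
        using integrable_logdet_Mmat[OF SX SS SZ_pd K_prob[OF elim(2)] sets_K[OF elim(2)]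
            integrable_ln_norm[OF elim(2,1)], of W] logdet_Mmat_ge[OF SX SS SZ_pd, of W]
        by (intro Kb.integral_ge_const) auto
      then have "logdet SX + logdet SZ \<le> (INF W. \<integral>h. logdet (Mmat SX (P *\<^sub>R SS') SZ W h) \<partial>K b)"
        by (intro cINF_greatest) auto
      with 1 show ?case
        by (simp add: rate_at_def G_def)
    qed
  qed
qed

lemma dpc_rate_le:
  obtains c where "\<And>P SX. P \<ge> 1 \<Longrightarrow> pos_def SX \<Longrightarrow> Re (trace SX) \<le> P \<Longrightarrow>
    dpc_rate mu K SZ (P *\<^sub>R SS') SX \<le> m * ln P + c"
proof -
  obtain G where G: "\<And>P b. P \<ge> 1 \<Longrightarrow> 0 \<le> m * ln P + G b" "integrable mu G"
    "\<And>P SX. P \<ge> 1 \<Longrightarrow> pos_def SX \<Longrightarrow> Re (trace SX) \<le> P \<Longrightarrow>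
      AE b in mu. rate_at (P *\<^sub>R SS') SX b \<le> m * ln P + G b"
    by (rule rate_at_le) blast
  show ?thesis
  proof (rule that[of "\<integral>b. G b \<partial>mu"])
    fix P :: real and SX :: "complex^'t^'t"
    assume *: "P \<ge> 1" "pos_def SX" "Re (trace SX) \<le> P"
    have "dpc_rate mu K SZ (P *\<^sub>R SS') SX \<le> (\<integral>b. m * ln P + G b \<partial>mu)"
      unfolding dpc_rate_eq using G(1)[OF *(1)] G(2) G(3)[OF *]
      by (intro integral_le_nonneg_majorant) auto
    also have "\<dots> = m * ln P + (\<integral>b. G b \<partial>mu)"
      using G(2) by (simp add: mu.prob_space)
    finally show "dpc_rate mu K SZ (P *\<^sub>R SS') SX \<le> m * ln P + (\<integral>b. G b \<partial>mu)" .
  qed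
qed

section \<open>Lower bound for the rate through the Gram determinant\<close>

lemma gram_det_measurable [measurable]: "(gram_det :: complex^'t^'r \<Rightarrow> complex) \<in> borel_measurable borel"
proof (rule borel_measurable_continuous_onI)
  show "continuous_on UNIV (gram_det :: complex^'t^'r \<Rightarrow> complex)"
    unfolding gram_det_def
    by (cases "CARD('t) \<le> CARD('r)")
      (simp_all add: continuous_on_det continuous_on_matrix_mult continuous_on_ctrans)
qed

definition gram_logdet :: "complex^'t^'r \<Rightarrow> real" where
  "gram_logdet h = ln (cmod (gram_det h))"

lemma gram_logdet_measurable: "gram_logdet \<in> borel_measurable borel"
  unfolding gram_logdet_def by measurable

lemma AE_integrable_gram_logdet: "AE b in mu. integrable (K b) gram_logdet"
  and integrable_integral_gram_logdet: "integrable mu (\<lambda>b. \<integral>h. \<bar>gram_logdet h\<bar> \<partial>K b)"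
proof -
  have int: "integrable (mu \<bind> K) (\<lambda>h. \<bar>gram_logdet h\<bar>)"
    unfolding gram_logdet_def gram_det_def using logdet_int_le logdet_int_gt
    by (cases "CARD('t) \<le> CARD('r)") (auto simp: logdet_def)
  have meas: "(\<lambda>h. \<bar>gram_logdet h\<bar>) \<in> borel_measurable borel"
    using gram_logdet_measurable by measurable
  note * = integrable_bind_nonneg[OF meas _ int, simplified]
  show "integrable mu (\<lambda>b. \<integral>h. \<bar>gram_logdet h\<bar> \<partial>K b)"
    by (rule *(2))
  show "AE b in mu. integrable (K b) gram_logdet"
    using *(1) AE_space
  proof eventually_elim
    case (elim b)
    then show ?case
      using integrable_abs_iff[of gram_logdet "K b"] borel_measurable_K[OF gram_logdet_measurable] by blast
  qed
qed

text \<open>\<open>AE_bind\<close> asks for a measurable predicate, so the rank condition is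
  replaced by \<open>gram_det\<close> before passing to the conditional laws.\<close>

lemma AE_gram_det_nonzero: "AE b in mu. AE h in K b. gram_det h \<noteq> 0"
proof -
  have "Measurable.pred borel (\<lambda>h :: complex^'t^'r. gram_det h \<noteq> 0)"
    by measurable
  moreover have "AE h in mu \<bind> K. gram_det h \<noteq> 0"
    using full_rank by eventually_elim (rule gram_det_nonzero, simp add: m_eq)
  ultimately show ?thesis
    using AE_bind[OF K_meas] by blast
qed

text \<open>With isotropic input and \<open>W = mat 1\<close>, the \<open>CARD('t) * ln P\<close>
  terms of \<open>logdet SX\<close> and \<open>logdet (SX + SS)\<close> cancel; the growth
  \<open>m * ln P\<close> comes from the received covariance alone.\<close>

lemma rate_at_ge:
  obtains L P0 where "integrable mu L"
    "\<And>P. P \<ge> P0 \<Longrightarrow>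
      rate_at (P *\<^sub>R SS') ((P / CARD('t)) *\<^sub>R mat 1) \<in> borel_measurable mu \<and>
      (AE b in mu. m * ln P + L b \<le> rate_at (P *\<^sub>R SS') ((P / CARD('t)) *\<^sub>R mat 1) b)"
proof -
  define \<tau> where "\<tau> = 1 / CARD('t)"
  have \<tau>: "\<tau> > 0"
    by (simp add: \<tau>_def)
  define J where "J = \<tau> *\<^sub>R (mat 1 :: complex^'t^'t)"
  have J: "pos_def J"
    unfolding J_def by (rule pos_def_scaleR[OF pos_def_mat_1 \<tau>])
  have det_nz: "det A \<noteq> 0" if "pos_def A" for A :: "complex^'t^'t"
    using pos_def_det_pos[OF that] by auto
  obtain c where c: "c > 0" and ge:
    "\<And>Q s (h :: complex^'t^'r). hermitian Q \<Longrightarrow> s > 0 \<Longrightarrow> (\<And>x. s * (norm x)\<^sup>2 \<le> Re (qform Q x)) \<Longrightarrow>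
      gram_det h \<noteq> 0 \<Longrightarrow> c * s ^ m * cmod (gram_det h) \<le> cmod (det (h ** Q ** ctrans h + SZ))"
    unfolding m_eq by (rule det_receive_ge[OF SZ_pd]) blast
  define d where "d = logdet J - logdet (J + SS') + ln c + m * ln \<tau> - logdet SZ"
  \<comment> \<open>The absolute value is inside the integral because
    \<open>integrable_bind_nonneg\<close> yields integrability in \<open>b\<close> for nonnegative
    integrands.\<close>
  define L where "L b = d - (\<integral>h. \<bar>gram_logdet h\<bar> \<partial>K b)" for b
  \<comment> \<open>Beyond this threshold \<open>logdet SX + logdet SZ\<close> is nonnegative, as
    \<open>INF_logdet_measurable\<close> requires.\<close>
  define P0 where "P0 = max 1 (exp (- logdet J - logdet SZ))"
  show ?thesis
  proof (rule that[of L P0])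
    show "integrable mu L"
      unfolding L_def using integrable_integral_gram_logdet by simp
    fix P :: real
    assume "P \<ge> P0"
    then have P: "P \<ge> 1" and P': "exp (- logdet J - logdet SZ) \<le> P"
      by (simp_all add: P0_def)
    define SX where "SX = P *\<^sub>R J"
    define SS where "SS = P *\<^sub>R SS'"
    have SX_eq: "(P / CARD('t)) *\<^sub>R mat 1 = SX"
      by (simp add: SX_def J_def \<tau>_def)
    have SX: "pos_def SX"
      unfolding SX_def using P by (intro pos_def_scaleR J) simp
    have SS: "pos_semidef SS"
      unfolding SS_def using P by (intro pos_semidef_scaleR SS'_psd) simp
    have tr: "Re (trace SX) \<le> P"
      using P by (simp add: SX_def J_def \<tau>_def trace_def mat_def)
    have logdet_SX: "logdet SX = CARD('t) * ln P + logdet J"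
      unfolding SX_def using P by (intro logdet_scaleR det_nz J) simp
    have "SX + SS = P *\<^sub>R (J + SS')"
      by (simp add: SX_def SS_def scaleR_right_distrib)
    then have logdet_sum: "logdet (SX + SS) = CARD('t) * ln P + logdet (J + SS')"
      using P logdet_scaleR[OF _ det_nz[OF pos_def_add[OF J SS'_psd]], of P] by simp
    have "- logdet J - logdet SZ \<le> ln P"
      using P P' by (simp add: ln_ge_iff)
    also have "\<dots> \<le> CARD('t) * ln P"
      using P mult_right_mono[of 1 "real CARD('t)" "ln P"] by simp
    finally have nonneg: "0 \<le> logdet SX + logdet SZ"
      using logdet_SX by simp
    have "rate_at SS SX \<in> borel_measurable mu"
      unfolding rate_at_def
      by (intro borel_measurable_diff INF_logdet_measurable[OF SX SS nonneg] integral_K_measurable) measurable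
    moreover have "AE b in mu. m * ln P + L b \<le> rate_at SS SX b"
      using AE_integrable_norm AE_integrable_gram_logdet AE_gram_det_nonzero AE_space
    proof eventually_elim
      case (elim b)
      interpret Kb: prob_space "K b"
        by (rule K_prob[OF elim(4)])
      have int_M: "integrable (K b) (\<lambda>h. logdet (Mmat SX SS SZ W h))" for W
        by (rule integrable_logdet_Mmat[OF SX SS SZ_pd K_prob[OF elim(4)] sets_K[OF elim(4)]
            integrable_ln_norm[OF elim(4,1)]])
      have "bdd_below (range (\<lambda>W. \<integral>h. logdet (Mmat SX SS SZ W h) \<partial>K b))"
        using int_M logdet_Mmat_ge[OF SX SS SZ_pd]
        by (intro bdd_belowI[of _ "logdet SX + logdet SZ"]) (auto intro!: Kb.integral_ge_const)
      then have "(INF W. \<integral>h. logdet (Mmat SX SS SZ W h) \<partial>K b) \<le> (\<integral>h. logdet (Mmat SX SS SZ (mat 1) h) \<partial>K b)"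
        by (rule cINF_lower) simp
      also have "\<dots> = logdet (SX + SS) + logdet SZ"
        using det_nz[OF pos_def_add[OF SX SS]] pos_def_det_pos[OF SZ_pd]
        by (simp add: logdet_def det_Mmat_mat_1 norm_mult ln_mult_pos Kb.prob_space)
      finally have inf: "(INF W. \<integral>h. logdet (Mmat SX SS SZ W h) \<partial>K b) \<le> logdet (SX + SS) + logdet SZ" .
      have herm: "hermitian (SX + SS)"
        using pos_def_add[OF SX SS] by (simp add: pos_def_def)
      have qf: "P * \<tau> * (norm x)\<^sup>2 \<le> Re (qform (SX + SS) x)" for x
        using SS by (simp add: SX_def J_def pos_semidef_def qform_add qform_scaleR qform_mat_1 del: of_real_power)
      have P\<tau>: "P * \<tau> > 0"
        using P \<tau> by simp
      have ptw: "ln c + m * (ln P + ln \<tau>) + gram_logdet h \<le> logdet (h ** (SX + SS) ** ctrans h + SZ)"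
        if nz: "gram_det h \<noteq> 0" for h
      proof -
        have "ln c + m * (ln P + ln \<tau>) + gram_logdet h = ln (c * (P * \<tau>) ^ m * cmod (gram_det h))"
          using c nz P \<tau> by (simp add: gram_logdet_def ln_mult_pos ln_realpow)
        also have "\<dots> \<le> logdet (h ** (SX + SS) ** ctrans h + SZ)"
          unfolding logdet_def using c P \<tau> nz
          by (intro ln_mono[OF ge[OF herm P\<tau> qf nz]] mult_pos_pos zero_less_power) auto
        finally show ?thesis .
      qed
      have int_R: "integrable (K b) (\<lambda>h. logdet (h ** (SX + SS) ** ctrans h + SZ))"
        unfolding SS_def by (rule integrable_logdet_receive[OF elim(4,1) P SX tr])
      have "logdet SX + (ln c + m * (ln P + ln \<tau>)) - (\<integral>h. \<bar>gram_logdet h\<bar> \<partial>K b)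
          \<le> logdet SX + (ln c + m * (ln P + ln \<tau>)) + (\<integral>h. gram_logdet h \<partial>K b)"
        using integral_abs_bound[of "K b" gram_logdet] by linarith
      also have "\<dots> = (\<integral>h. logdet SX + (ln c + m * (ln P + ln \<tau>) + gram_logdet h) \<partial>K b)"
        using elim(2) by (simp add: Kb.prob_space)
      also have "\<dots> \<le> (\<integral>h. logdet SX + logdet (h ** (SX + SS) ** ctrans h + SZ) \<partial>K b)"
        using elim(2,3) int_R ptw by (intro integral_mono_AE) auto
      finally show ?case
        using inf logdet_SX logdet_sum by (simp add: rate_at_def L_def d_def algebra_simps)
    qed
    ultimately show "rate_at (P *\<^sub>R SS') ((P / CARD('t)) *\<^sub>R mat 1) \<in> borel_measurable mu \<and>
      (AE b in mu. m * ln P + L b \<le> rate_at (P *\<^sub>R SS') ((P / CARD('t)) *\<^sub>R mat 1) b)"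
      by (simp add: SX_eq SS_def)
  qed
qed

lemma pos_def_isotropic: "P > 0 \<Longrightarrow> pos_def ((P / CARD('t)) *\<^sub>R (mat 1 :: complex^'t^'t))"
  by (intro pos_def_scaleR pos_def_mat_1) simp

lemma trace_isotropic: "Re (trace ((P / CARD('t)) *\<^sub>R (mat 1 :: complex^'t^'t))) = P"
  by (simp add: trace_def mat_def)

text \<open>Integrating the pointwise bound requires an integrable rate, as the integral would
  otherwise default to 0. Integrability follows from measurability and the two integrable bounds
  around the rate.\<close>

lemma dpc_rate_ge:
  obtains c P0 where "\<And>P. P \<ge> P0 \<Longrightarrow>
    m * ln P + c \<le> dpc_rate mu K SZ (P *\<^sub>R SS') ((P / CARD('t)) *\<^sub>R mat 1)"
proof -
  obtain L P0 where L: "integrable mu L" and ge: "\<And>P. P \<ge> P0 \<Longrightarrow>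
      rate_at (P *\<^sub>R SS') ((P / CARD('t)) *\<^sub>R mat 1) \<in> borel_measurable mu \<and>
      (AE b in mu. m * ln P + L b \<le> rate_at (P *\<^sub>R SS') ((P / CARD('t)) *\<^sub>R mat 1) b)"
    by (rule rate_at_ge) blast
  obtain G where G: "integrable mu G"
    "\<And>P SX. P \<ge> 1 \<Longrightarrow> pos_def SX \<Longrightarrow> Re (trace SX) \<le> P \<Longrightarrow>
      AE b in mu. rate_at (P *\<^sub>R SS') SX b \<le> m * ln P + G b"
    by (rule rate_at_le) blast
  show ?thesis
  proof (rule that[of "max 1 P0" "\<integral>b. L b \<partial>mu"])
    fix P :: real
    assume "P \<ge> max 1 P0"
    then have P: "P \<ge> 1" "P \<ge> P0"
      by simp_all
    let ?R = "rate_at (P *\<^sub>R SS') ((P / CARD('t)) *\<^sub>R mat 1)"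
    have le: "AE b in mu. ?R b \<le> m * ln P + G b"
      using P(1) by (intro G(2) pos_def_isotropic) (simp_all only: trace_isotropic)
    have "integrable mu ?R"
    proof (rule Bochner_Integration.integrable_bound)
      show "integrable mu (\<lambda>b. \<bar>m * ln P + G b\<bar> + \<bar>m * ln P + L b\<bar>)"
        using G(1) L by simp
      show "AE b in mu. norm (?R b) \<le> norm (\<bar>m * ln P + G b\<bar> + \<bar>m * ln P + L b\<bar>)"
        using le ge[OF P(2), THEN conjunct2]
      proof eventually_elim
        case (elim b)
        then show ?case
          unfolding real_norm_def by linarith
      qed
    qed (use ge[OF P(2)] in blast)
    then have "(\<integral>b. m * ln P + L b \<partial>mu) \<le> (\<integral>b. ?R b \<partial>mu)"
      using ge[OF P(2)] L by (intro integral_mono_AE) auto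
    then show "m * ln P + (\<integral>b. L b \<partial>mu) \<le> dpc_rate mu K SZ (P *\<^sub>R SS') ((P / CARD('t)) *\<^sub>R mat 1)"
      using L by (simp add: dpc_rate_eq mu.prob_space)
  qed
qed

section \<open>The supremum over input covariances and the limit\<close>

lemma dpc_rate_P_scaling:
  "((\<lambda>P. dpc_rate_P mu K SZ SS' P / ln (P / cmod (det SZ))) \<longlongrightarrow> real m) at_top"
proof -
  obtain c1 P1 where lower: "\<And>P. P \<ge> P1 \<Longrightarrow>
      m * ln P + c1 \<le> dpc_rate mu K SZ (P *\<^sub>R SS') ((P / CARD('t)) *\<^sub>R mat 1)"
    by (rule dpc_rate_ge) blast
  obtain c2 where upper: "\<And>P SX. P \<ge> 1 \<Longrightarrow> pos_def SX \<Longrightarrow> Re (trace SX) \<le> P \<Longrightarrow>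
      dpc_rate mu K SZ (P *\<^sub>R SS') SX \<le> m * ln P + c2"
    by (rule dpc_rate_le) blast
  define \<delta> where "\<delta> = cmod (det SZ)"
  have \<delta>: "\<delta> > 0"
    unfolding \<delta>_def by (rule pos_def_det_pos[OF SZ_pd])
  \<comment> \<open>The upper bound also shows that the supremum is over a set bounded above,
    without which the isotropic rate could not be compared with it.\<close>
  have bounds: "m * ln P + c1 \<le> dpc_rate_P mu K SZ SS' P" "dpc_rate_P mu K SZ SS' P \<le> m * ln P + c2"
    if P: "P \<ge> max 1 P1" for P
  proof -
    let ?A = "{SX :: complex^'t^'t. pos_def SX \<and> Re (trace SX) \<le> P}"
    have iso: "(P / CARD('t)) *\<^sub>R mat 1 \<in> ?A"
      using P by (simp only: mem_Collect_eq trace_isotropic) (auto intro: pos_def_isotropic)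
    have le: "dpc_rate mu K SZ (P *\<^sub>R SS') SX \<le> m * ln P + c2" if "SX \<in> ?A" for SX
      using that P by (intro upper) auto
    show "dpc_rate_P mu K SZ SS' P \<le> m * ln P + c2"
      unfolding dpc_rate_P_def using iso le by (intro cSUP_least) auto
    have "dpc_rate mu K SZ (P *\<^sub>R SS') ((P / CARD('t)) *\<^sub>R mat 1) \<le> dpc_rate_P mu K SZ SS' P"
      unfolding dpc_rate_P_def using le by (intro cSUP_upper iso bdd_aboveI[of _ "m * ln P + c2"]) auto
    then show "m * ln P + c1 \<le> dpc_rate_P mu K SZ SS' P"
      using lower[of P] P by simp
  qed
  have lim: "((\<lambda>P. (m * ln P + c) / (ln P - ln \<delta>)) \<longlongrightarrow> m) at_top" for c
    by real_asymp
  have ln_pos: "eventually (\<lambda>P. 0 < ln P - ln \<delta>) at_top"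
    by real_asymp
  have ev: "eventually (\<lambda>P. P \<ge> max 1 P1) at_top"
    by (rule eventually_ge_at_top)
  have "((\<lambda>P. dpc_rate_P mu K SZ SS' P / (ln P - ln \<delta>)) \<longlongrightarrow> real m) at_top"
  proof (rule tendsto_sandwich[OF _ _ lim[of c1] lim[of c2]])
    show "\<forall>\<^sub>F P in at_top. (m * ln P + c1) / (ln P - ln \<delta>) \<le> dpc_rate_P mu K SZ SS' P / (ln P - ln \<delta>)"
      using ev ln_pos by eventually_elim (simp add: bounds divide_right_mono)
    show "\<forall>\<^sub>F P in at_top. dpc_rate_P mu K SZ SS' P / (ln P - ln \<delta>) \<le> (m * ln P + c2) / (ln P - ln \<delta>)"
      using ev ln_pos by eventually_elim (simp add: bounds divide_right_mono)
  qed
  moreover have "eventually (\<lambda>P. dpc_rate_P mu K SZ SS' P / (ln P - ln \<delta>) =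
      dpc_rate_P mu K SZ SS' P / ln (P / cmod (det SZ))) at_top"
    using eventually_gt_at_top[of 0] by eventually_elim (use \<delta> in \<open>simp add: \<delta>_def ln_div\<close>)
  ultimately show ?thesis
    by (rule Lim_transform_eventually)
qed

end

theorem theorem1:
  fixes mu :: "'b measure"
    and K :: "'b \<Rightarrow> (complex^'t^'r) measure"
    and SZ :: "complex^'r^'r"
    and SS' :: "complex^'t^'t"
  assumes mu_prob: "prob_space mu"
    and K_meas: "K \<in> measurable mu (subprob_algebra borel)"
    and K_prob: "\<And>b. b \<in> space mu \<Longrightarrow> prob_space (K b)"
    and full_rank: "AE h in (mu \<bind> K). rank h = min CARD('t) CARD('r)"
    and frob: "integrable (mu \<bind> K) (\<lambda>h. (norm h)\<^sup>2)"
    and logdet_int_le: "CARD('t) \<le> CARD('r) \<Longrightarrow>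
                   integrable (mu \<bind> K) (\<lambda>h. logdet (ctrans h ** h))"
    and logdet_int_gt: "CARD('t) > CARD('r) \<Longrightarrow>
                   integrable (mu \<bind> K) (\<lambda>h. logdet (h ** ctrans h))"
    and SZ_pd: "pos_def SZ"
    and SS'_psd: "pos_semidef SS'"
  shows "((\<lambda>P. dpc_rate_P mu K SZ SS' P / ln (P / cmod (det SZ)))
            \<longlongrightarrow> real (min CARD('t) CARD('r))) at_top"
proof -
  interpret fading_channel mu K SZ SS' "min CARD('t) CARD('r)"
    by (rule fading_channel.intro; fact assms refl)
  show ?thesis
    by (rule dpc_rate_P_scaling)
qed

end
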